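(* Consider the network with node set $V=\{1,2,3\}$, directed links $E=\{(1,2),(1,3),(2,3),(3,2)\}$, all link capacities $c_{12}=c_{13}=c_{23}=c_{32}=1$, and arrival rates $\lambda_1=2-\varepsilon$, $\lambda_2=\lambda_3=0$. There exists $\delta>0$ such that for every $\varepsilon\in(0,\delta)$ the condition $$\sum_{u\in S}\lambda_u<\sum_{(u,v)\in E:\ u\in S,\ v\notin S}c_{uv}\qquad\text{for every } S\subset V,\ S\neq V,\ \text{with } \sum_{u\in S}\lambda_u>0$$ holds, but the network under the Oldest-Useful discipline is not stable. Consequently, in general the Oldest-Useful discipline does not achieve the maximum stability region.
   Context: Network model. Given a finite directed graph $H=(V,E)$: at each node $u\in V$ new packets are created (arrive exogenously) according to a Poisson process of rate $\lambda_u\ge0$; $u$ is the source of these packets. For each link $(u,v)\in E$ there is a Poisson process of rate $c_{uv}>0$ of communication epochs; at each such epoch node $u$ may instantly transmit a copy of one packet to node $v$ (keeping its own copy). All these Poisson processes are mutually independent. A packet leaves the network as soon as it is available at all nodes of $V$. A packet is useful on link $(u,v)$ at a given time if it is available at $u$ but not at $v$ (it need not have source $u$). Oldest-Useful discipline: at each communication epoch of link $(u,v)$, the oldest (earliest exogenously arrived) packet among those currently useful on $(u,v)$ is transmitted; if there is none, nothing happens. State and stability. The packets present are labelled $1,\dots,k$ in order of exogenous arrival (1 is the oldest), labels being decremented when an older packet leaves; the state $X(t)$ records, for each present packet, its source and the set of nodes at which it is available. $X(\cdot)$ is a continuous-time Markov chain on the countable set of states reachable from the empty state. The network is stable if $X(\cdot)$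 is positive recurrent (equivalently, has a stationary distribution). The displayed cut condition is necessary for stability under any discipline, and there is a discipline (Random-Useful: transmit a uniformly random useful packet) under which it is also sufficient; a discipline achieves the maximum stability region if the condition is sufficient for stability under it. *)

theory Defs
  imports "HOL-Probability.Probability"
begin

section \<open>Networks, packets and disciplines\<close>

record 'v network =
  nodes :: "'v set"
  links :: "('v \<times> 'v) set"
  arr :: "'v \<Rightarrow> real"
  cap :: "'v \<times> 'v \<Rightarrow> real"

definition network :: "'v network \<Rightarrow> bool" where
  "network N \<longleftrightarrow> finite (nodes N) \<and> nodes N \<noteq> {} \<and> links N \<subseteq> nodes N \<times> nodes N
     \<and> (\<forall>u\<in>nodes N. 0 \<le> arr N u) \<and> (\<forall>l\<in>links N. 0 < cap N l)"

text \<open>A packet is its source together with the set of nodes at which it is available. A state lists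
  the packets present from oldest to youngest, so the packet labelled \<open>i\<close> is the one at
  position \<open>i - 1\<close>.\<close>

type_synonym 'v packet = "'v \<times> 'v set"
type_synonym 'v state = "'v packet list"

definition useful :: "'v packet \<Rightarrow> 'v \<times> 'v \<Rightarrow> bool" where
  "useful p l \<longleftrightarrow> fst l \<in> snd p \<and> snd l \<notin> snd p"

text \<open>A (deterministic) discipline selects the position of the packet to be transmitted at a
  communication epoch of the given link, if any.\<close>

type_synonym 'v discipline = "'v state \<Rightarrow> 'v \<times> 'v \<Rightarrow> nat option"

definition oldest_useful :: "'v discipline" where
  "oldest_useful x l =
     (if \<exists>i<length x. useful (x ! i) l
      then Some (LEAST i. i < length x \<and> useful (x ! i) l) else None)"

section \<open>Effect of arrivals and communication epochs\<close>

datatype 'v event = Arrival 'v | Comm "'v \<times> 'v"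

definition discard_complete :: "'v network \<Rightarrow> 'v state \<Rightarrow> 'v state" where
  "discard_complete N x = filter (\<lambda>p. \<not> nodes N \<subseteq> snd p) x"

text \<open>A selected packet is only transmitted if it is useful on the link, so that every function of
  the above type is an admissible discipline.\<close>

definition transmit :: "'v discipline \<Rightarrow> 'v \<times> 'v \<Rightarrow> 'v state \<Rightarrow> 'v state" where
  "transmit D l x =
     (case D x l of
        None \<Rightarrow> x
      | Some i \<Rightarrow> if i < length x \<and> useful (x ! i) l
                  then x[i := (fst (x ! i), insert (snd l) (snd (x ! i)))] else x)"

fun event_step :: "'v discipline \<Rightarrow> 'v network \<Rightarrow> 'v event \<Rightarrow> 'v state \<Rightarrow> 'v state" where
  "event_step D N (Arrival u) x = discard_complete N (x @ [(u, {u})])"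
| "event_step D N (Comm l) x = discard_complete N (transmit D l x)"

section \<open>The driving Poisson processes\<close>

fun event_rate :: "'v network \<Rightarrow> 'v event \<Rightarrow> real" where
  "event_rate N (Arrival u) = arr N u"
| "event_rate N (Comm l) = cap N l"

text \<open>A Poisson process of rate 0 has no points, so only events of positive rate get a clock.\<close>

definition clocks :: "'v network \<Rightarrow> 'v event set" where
  "clocks N = {e \<in> Arrival ` nodes N \<union> Comm ` links N. 0 < event_rate N e}"

text \<open>The outcome \<open>\<omega> (e, n)\<close> is the time between the \<open>n\<close>-th and the \<open>(n + 1)\<close>-st point of the
  Poisson process of \<open>e\<close> (from time 0 to the first point for \<open>n = 0\<close>). All these times are
  independent, and those of \<open>e\<close> are exponential with parameter \<open>event_rate N e\<close>.\<close>

definition poisson_space :: "'v network \<Rightarrow> ('v event \<times> nat \<Rightarrow> real) measure" where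
  "poisson_space N =
     (\<Pi>\<^sub>M i\<in>clocks N \<times> UNIV. density lborel (exponential_density (event_rate N (fst i))))"

definition epoch :: "('v event \<times> nat \<Rightarrow> real) \<Rightarrow> 'v event \<Rightarrow> nat \<Rightarrow> real" where
  "epoch \<omega> e n = (\<Sum>k\<le>n. \<omega> (e, k))"

section \<open>The process \<open>X(t)\<close> and stability\<close>

definition epochs_until :: "'v network \<Rightarrow> ('v event \<times> nat \<Rightarrow> real) \<Rightarrow> real \<Rightarrow> real set" where
  "epochs_until N \<omega> t = {s. s \<le> t \<and> (\<exists>e\<in>clocks N. \<exists>n. s = epoch \<omega> e n)}"

text \<open>Almost surely the points of distinct Poisson processes are distinct, so that \<open>event_at\<close> is
  uniquely determined at every epoch, and only finitely many of them fall in a bounded interval.\<close>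

definition event_at :: "'v network \<Rightarrow> ('v event \<times> nat \<Rightarrow> real) \<Rightarrow> real \<Rightarrow> 'v event" where
  "event_at N \<omega> s = (SOME e. e \<in> clocks N \<and> (\<exists>n. s = epoch \<omega> e n))"

text \<open>The state at time \<open>t\<close> when the state at time 0 is \<open>x\<close>.\<close>

definition state_at :: "'v discipline \<Rightarrow> 'v network \<Rightarrow> 'v state \<Rightarrow> ('v event \<times> nat \<Rightarrow> real) \<Rightarrow> real \<Rightarrow> 'v state"
  where "state_at D N x \<omega> t =
    fold (\<lambda>s. event_step D N (event_at N \<omega> s)) (sorted_list_of_set (epochs_until N \<omega> t)) x"

inductive_set state_space :: "'v discipline \<Rightarrow> 'v network \<Rightarrow> 'v state set"
  for D :: "'v discipline" and N :: "'v network" where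
  empty: "[] \<in> state_space D N"
| step: "x \<in> state_space D N \<Longrightarrow> e \<in> clocks N \<Longrightarrow> event_step D N e x \<in> state_space D N"

text \<open>The first time at which the process is in its initial state again after having left it
  (infinite if there is no such time).\<close>

definition return_time ::
  "'v discipline \<Rightarrow> 'v network \<Rightarrow> 'v state \<Rightarrow> ('v event \<times> nat \<Rightarrow> real) \<Rightarrow> ennreal" where
  "return_time D N x \<omega> =
     Inf (ennreal ` {t. \<exists>s. 0 \<le> s \<and> s < t \<and> state_at D N x \<omega> s \<noteq> x \<and> state_at D N x \<omega> t = x})"

definition absorbing :: "'v discipline \<Rightarrow> 'v network \<Rightarrow> 'v state \<Rightarrow> bool" where
  "absorbing D N x \<longleftrightarrow> (AE \<omega> in poisson_space N. \<forall>t\<ge>0. state_at D N x \<omega> t = x)"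

text \<open>Absorbing states count as positive recurrent, as usual in continuous time. They only occur in
  degenerate networks (for instance without any arrivals).\<close>

definition positive_recurrent_state :: "'v discipline \<Rightarrow> 'v network \<Rightarrow> 'v state \<Rightarrow> bool" where
  "positive_recurrent_state D N x \<longleftrightarrow>
     absorbing D N x \<or> (\<integral>\<^sup>+ \<omega>. return_time D N x \<omega> \<partial>poisson_space N) < \<infinity>"

definition stable_network :: "'v discipline \<Rightarrow> 'v network \<Rightarrow> bool" where
  "stable_network D N \<longleftrightarrow> (\<forall>x\<in>state_space D N. positive_recurrent_state D N x)"

definition cut_condition :: "'v network \<Rightarrow> bool" where
  "cut_condition N \<longleftrightarrow>
     (\<forall>S. S \<subset> nodes N \<longrightarrow> 0 < (\<Sum>u\<in>S. arr N u) \<longrightarrow>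
        (\<Sum>u\<in>S. arr N u) < (\<Sum>l\<in>{(u, v) \<in> links N. u \<in> S \<and> v \<notin> S}. cap N l))"

definition achieves_max_stability_region :: "'v discipline \<Rightarrow> bool" where
  "achieves_max_stability_region D \<longleftrightarrow>
     (\<forall>N :: 'v network. network N \<longrightarrow> cut_condition N \<longrightarrow> stable_network D N)"

section \<open>The example\<close>

definition example_network :: "real \<Rightarrow> nat network" where
  "example_network \<epsilon> =
     \<lparr> nodes = {1, 2, 3},
       links = {(1, 2), (1, 3), (2, 3), (3, 2)},
       arr = (\<lambda>u. if u = 1 then 2 - \<epsilon> else 0),
       cap = (\<lambda>_. 1) \<rparr>"

end

theory Submission
  imports Defs
begin

text \<open>From the empty state every reachable state has the form: \<open>k\<close> packets available at
  \<open>{1, a}\<close> for one common \<open>a \<in> {2, 3}\<close>, followed by \<open>m\<close> packets available only at node 1. Packets that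
  are available at 2 only and packets that are available at 3 only never coexist, so one of the links
  (2,3) and (3,2) is always idle. Hence the number of receptions that are still needed grows at rate
  \<open>2 (2 - \<epsilon>)\<close> and decreases at rate at most 3. For \<open>W\<close> that number, \<open>(9/10) ^ W\<close> is therefore
  superharmonic, which makes the embedded jump chain transient. The passage from the Poisson clocks to
  one-step analysis is a restart identity: after the first ring, the residual clocks have the
  original law and are independent of which clock rang.\<close>

section \<open>Restarting the Poisson clocks at the first ring\<close>

text \<open>The loss of capacity comes from the order of service. While packets with availability
  set \<open>{1, a}\<close> are present, the oldest of them is useful on both links into the other
  node \<open>b\<close>. So \<open>(1, b)\<close> spends its epochs on that block instead of
  bringing fresh packets to \<open>b\<close>, and \<open>(b, a)\<close> has nothing to send. The
  roles of 2 and 3 can be exchanged only when the block is empty.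

  The base \<open>r = 9/10\<close> comes from the requirement
  \<open>(2 - \<epsilon>) r^2 + 1 + 3 / r \<le> 6 - \<epsilon>\<close>, whose terms on the left
  stand for arrivals, the idle link and three links that each remove at most one missing reception.
  Both sides agree at \<open>r = 1\<close>, where the derivative of the left side is
  \<open>2 (2 - \<epsilon>) - 3\<close>, a lower bound for the drift of \<open>W\<close>. This is
  positive for \<open>\<epsilon> < 1/2\<close>, so some \<open>r < 1\<close> fulfils the requirement
  strictly.

  Stability is stated for paths built from the gaps of Poisson clocks, so the Markov property must
  be derived from the product measure. Positive recurrence then fails because the return time is
  infinite on an event of positive probability.\<close>

lemma emeasure_exponential_shift:
  fixes l t :: real
  assumes l: "0 < l" and t: "0 \<le> t" and A[measurable]: "A \<in> sets borel"
  shows "emeasure (density lborel (exponential_density l)) {s. t < s \<and> s - t \<in> A}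
       = ennreal (exp (- l * t)) * emeasure (density lborel (exponential_density l)) A"
proof -
  have "emeasure (density lborel (exponential_density l)) {s. t < s \<and> s - t \<in> A}
      = (\<integral>\<^sup>+s. ennreal (exponential_density l s) * indicator {s. t < s \<and> s - t \<in> A} s \<partial>lborel)"
    by (rule emeasure_density) auto
  also have "\<dots> = (\<integral>\<^sup>+s. ennreal (exponential_density l (t + 1 * s))
      * indicator {s. t < s \<and> s - t \<in> A} (t + 1 * s) \<partial>lborel)"
    by (subst nn_integral_real_affine[where c=1 and t=t]) auto
  also have "\<dots> = (\<integral>\<^sup>+s. ennreal (exp (- l * t)) * (ennreal (exponential_density l s) * indicator A s) \<partial>lborel)"
  \<comment> \<open>The integrands can differ at \<open>s = 0\<close>, where the exponential density
    is positive but the strict inequality \<open>t < t + s\<close> fails.\<close>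
  proof (rule nn_integral_cong_AE)
    have "AE s in lborel. s \<noteq> (0::real)"
      by (rule AE_lborel_singleton)
    then show "AE s in lborel. ennreal (exponential_density l (t + 1 * s))
        * indicator {s. t < s \<and> s - t \<in> A} (t + 1 * s)
      = ennreal (exp (- l * t)) * (ennreal (exponential_density l s) * indicator A s)"
    proof eventually_elim
      case (elim s)
      show ?case
      proof (cases "0 < s \<and> s \<in> A")
        case True
        then have "exponential_density l (t + 1 * s) = exp (- l * t) * exponential_density l s"
          using t by (simp add: exponential_density_def algebra_simps exp_add[symmetric])
        with True show ?thesis
          using l by (simp add: ennreal_mult exponential_density_nonneg)
      next
        case False
        then show ?thesis
          using elim by (auto simp: exponential_density_def indicator_def)
      qed
    qed
  qed
  also have "\<dots> = ennreal (exp (- l * t)) * emeasure (density lborel (exponential_density l)) A"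
    by (subst nn_integral_cmult) (auto simp: emeasure_density)
  finally show ?thesis .
qed

abbreviation gap_law :: "'v network \<Rightarrow> 'v event \<times> nat \<Rightarrow> real measure" where
  "gap_law N i \<equiv> density lborel (exponential_density (event_rate N (fst i)))"

definition rings_first :: "'v network \<Rightarrow> 'v event \<Rightarrow> ('v event \<times> nat \<Rightarrow> real) \<Rightarrow> bool" where
  "rings_first N e \<omega> \<longleftrightarrow> (\<forall>e'\<in>clocks N - {e}. \<omega> (e, 0) < \<omega> (e', 0))"

text \<open>Restarted gaps are read off from the old ones through this injection, whose range misses
  \<open>(e, 0)\<close>. Injectivity allows products over the old coordinates to be
  reindexed.\<close>

definition next_index :: "'v event \<Rightarrow> 'v event \<times> nat \<Rightarrow> 'v event \<times> nat" where
  "next_index e i = (if fst i = e then (e, Suc (snd i)) else i)"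

text \<open>The gaps seen from the first ring on, when that ring is of \<open>e\<close>: the clock \<open>e\<close> drops its
  first gap, and the first gap of every other clock is shortened by the time elapsed.\<close>

definition restart :: "'v network \<Rightarrow> 'v event \<Rightarrow> ('v event \<times> nat \<Rightarrow> real) \<Rightarrow> 'v event \<times> nat \<Rightarrow> real" where
  "restart N e \<omega> = (\<lambda>i\<in>clocks N \<times> UNIV.
     \<omega> (next_index e i) - (if snd i = 0 \<and> fst i \<noteq> e then \<omega> (e, 0) else 0))"

lemma inj_next_index: "inj (next_index e)"
  by (auto simp: inj_def next_index_def split: if_splits)

lemma next_index_neq: "next_index e i \<noteq> (e, 0)"
  by (auto simp: next_index_def)

lemma fst_next_index [simp]: "fst (next_index e i) = fst i"
  by (auto simp: next_index_def)

text \<open>Finiteness and nonemptiness ensure that the first gaps have a minimum and that the total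
  rate is a positive real.\<close>

locale finite_clocks =
  fixes N :: "'v network"
  assumes finite_clocks: "finite (clocks N)" and clocks_nonempty: "clocks N \<noteq> {}"
begin

abbreviation total_rate :: real where
  "total_rate \<equiv> \<Sum>e\<in>clocks N. event_rate N e"

lemma rate_pos: "e \<in> clocks N \<Longrightarrow> 0 < event_rate N e"
  by (auto simp: clocks_def)

lemma total_rate_pos: "0 < total_rate"
  using finite_clocks clocks_nonempty rate_pos by (intro sum_pos) auto

lemma prob_space_gap_law: "i \<in> clocks N \<times> UNIV \<Longrightarrow> prob_space (gap_law N i)"
  by (intro prob_space_exponential_density rate_pos) auto

lemma prob_space_poisson_space: "prob_space (poisson_space N)"
  unfolding poisson_space_def by (intro prob_space_PiM prob_space_gap_law)

lemma measurable_coordinate [measurable]: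
  "i \<in> clocks N \<times> UNIV \<Longrightarrow> (\<lambda>\<omega>. \<omega> i) \<in> borel_measurable (poisson_space N)"
  unfolding poisson_space_def using measurable_component_singleton[of i "clocks N \<times> UNIV" "gap_law N"]
  by (simp cong: measurable_cong_sets)

lemma measurable_rings_first [measurable]:
  assumes "e \<in> clocks N"
  shows "Measurable.pred (poisson_space N) (rings_first N e)"
proof -
  have "Measurable.pred (poisson_space N) (\<lambda>\<omega>. \<omega> (e, 0) < \<omega> (e', 0))" if "e' \<in> clocks N - {e}" for e'
    using that assms by (intro borel_measurable_pred_less measurable_coordinate) auto
  then show ?thesis
    unfolding rings_first_def using finite_clocks
    by (intro pred_intros_finite) auto
qed

lemma measurable_restart [measurable]:
  assumes "e \<in> clocks N"
  shows "restart N e \<in> measurable (poisson_space N) (poisson_space N)"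
proof -
  have "(\<lambda>\<omega>. \<lambda>i\<in>clocks N \<times> UNIV.
      \<omega> (next_index e i) - (if snd i = 0 \<and> fst i \<noteq> e then \<omega> (e, 0) else 0))
     \<in> measurable (poisson_space N) (PiM (clocks N \<times> UNIV) (gap_law N))"
  proof (rule measurable_restrict)
    fix i :: "'v event \<times> nat" assume i: "i \<in> clocks N \<times> UNIV"
    then have [measurable]: "(\<lambda>\<omega>. \<omega> (next_index e i)) \<in> borel_measurable (poisson_space N)"
      "(\<lambda>\<omega>. \<omega> (e, 0)) \<in> borel_measurable (poisson_space N)"
      using assms by (auto intro!: measurable_coordinate simp: next_index_def)
    show "(\<lambda>\<omega>. \<omega> (next_index e i) - (if snd i = 0 \<and> fst i \<noteq> e then \<omega> (e, 0) else 0))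
        \<in> measurable (poisson_space N) (gap_law N i)"
      by simp
  qed
  then show ?thesis
    unfolding restart_def poisson_space_def by simp
qed

lemma sets_after_restart:
  assumes e: "e \<in> clocks N" and Q: "Q \<in> sets (poisson_space N)"
  shows "{\<omega> \<in> space (poisson_space N). rings_first N e \<omega> \<and> restart N e \<omega> \<in> Q} \<in> sets (poisson_space N)"
proof -
  have "{\<omega> \<in> space (poisson_space N). rings_first N e \<omega> \<and> restart N e \<omega> \<in> Q}
      = {\<omega> \<in> space (poisson_space N). rings_first N e \<omega>} \<inter> (restart N e -` Q \<inter> space (poisson_space N))"
    by auto
  also have "\<dots> \<in> sets (poisson_space N)"
    using measurable_rings_first[OF e]
    by (intro sets.Int measurable_sets[OF measurable_restart[OF e] Q]) (simp add: pred_def)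
  finally show ?thesis .
qed

section \<open>Separating the first gap of one clock from all other gaps\<close>

lemma poisson_space_split:
  assumes "e \<in> clocks N"
  shows "poisson_space N = distr (gap_law N (e, 0) \<Otimes>\<^sub>M PiM (clocks N \<times> UNIV - {(e, 0)}) (gap_law N))
     (poisson_space N) (\<lambda>(t, X). X((e, 0) := t))"
proof -
  have "insert (e, 0) (clocks N \<times> UNIV - {(e, 0)}) = clocks N \<times> UNIV"
    using assms by auto
  moreover have "prob_space (gap_law N i)" if "i \<in> clocks N \<times> UNIV - {(e, 0)}" for i
    using that by (intro prob_space_gap_law) auto
  moreover have "prob_space (gap_law N (e, 0))"
    using assms by (intro prob_space_gap_law) auto
  ultimately show ?thesis
    using distr_pair_PiM_eq_PiM[of "clocks N \<times> UNIV - {(e, 0)}" "gap_law N" "(e, 0)"]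
    unfolding poisson_space_def by metis
qed

lemma measurable_join:
  assumes "e \<in> clocks N"
  shows "(\<lambda>(t, X). X((e, 0) := t)) \<in> measurable
    (gap_law N (e, 0) \<Otimes>\<^sub>M PiM (clocks N \<times> UNIV - {(e, 0)}) (gap_law N)) (poisson_space N)"
proof -
  have "clocks N \<times> UNIV = (clocks N \<times> UNIV - {(e, 0)}) \<union> {(e, 0)}"
    using assms by auto
  then show ?thesis
    unfolding poisson_space_def split_beta
    by (rule measurable_fun_upd[where J="clocks N \<times> UNIV - {(e, 0)}"]) measurable
qed

lemma emeasure_poisson_space_join:
  assumes e: "e \<in> clocks N" and A: "A \<in> sets (poisson_space N)"
  shows "emeasure (poisson_space N) A =
    emeasure (gap_law N (e, 0) \<Otimes>\<^sub>M PiM (clocks N \<times> UNIV - {(e, 0)}) (gap_law N))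
     ((\<lambda>(t, X). X((e, 0) := t)) -` A
       \<inter> space (gap_law N (e, 0) \<Otimes>\<^sub>M PiM (clocks N \<times> UNIV - {(e, 0)}) (gap_law N)))"
  using measurable_join[OF e] A
  by (subst poisson_space_split[OF e]) (simp add: emeasure_distr)

text \<open>The two orders of integration serve different ends: fixing the first gap of
  \<open>e\<close> leads to the restart identity, while fixing all other gaps shows that
  coincidences of epochs are null.\<close>

lemma emeasure_poisson_space_split:
  assumes e: "e \<in> clocks N" and A: "A \<in> sets (poisson_space N)"
  shows "emeasure (poisson_space N) A =
    (\<integral>\<^sup>+t. emeasure (PiM (clocks N \<times> UNIV - {(e, 0)}) (gap_law N))
       {X \<in> space (PiM (clocks N \<times> UNIV - {(e, 0)}) (gap_law N)). X((e, 0) := t) \<in> A} \<partial>gap_law N (e, 0))"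
    and "emeasure (poisson_space N) A =
    (\<integral>\<^sup>+X. emeasure (gap_law N (e, 0)) {t. X((e, 0) := t) \<in> A}
       \<partial>PiM (clocks N \<times> UNIV - {(e, 0)}) (gap_law N))"
proof -
  let ?R = "clocks N \<times> UNIV - {(e, 0)}"
  interpret R: prob_space "PiM ?R (gap_law N)"
    by (intro prob_space_PiM prob_space_gap_law) auto
  interpret E: prob_space "gap_law N (e, 0)"
    using e by (intro prob_space_gap_law) auto
  interpret ER: pair_sigma_finite "gap_law N (e, 0)" "PiM ?R (gap_law N)" ..
  note [measurable] = measurable_join[OF e] A
  have meas: "(\<lambda>(t, X). X((e, 0) := t)) -` A \<inter> space (gap_law N (e, 0) \<Otimes>\<^sub>M PiM ?R (gap_law N))
      \<in> sets (gap_law N (e, 0) \<Otimes>\<^sub>M PiM ?R (gap_law N))"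
    by measurable
  show "emeasure (poisson_space N) A = (\<integral>\<^sup>+t. emeasure (PiM ?R (gap_law N))
       {X \<in> space (PiM ?R (gap_law N)). X((e, 0) := t) \<in> A} \<partial>gap_law N (e, 0))"
    unfolding emeasure_poisson_space_join[OF e A] R.emeasure_pair_measure_alt[OF meas]
    by (intro nn_integral_cong arg_cong2[where f=emeasure]) (auto simp: space_pair_measure)
  show "emeasure (poisson_space N) A = (\<integral>\<^sup>+X. emeasure (gap_law N (e, 0)) {t. X((e, 0) := t) \<in> A}
       \<partial>PiM ?R (gap_law N))"
    unfolding emeasure_poisson_space_join[OF e A] ER.emeasure_pair_measure_alt2[OF meas]
    by (intro nn_integral_cong arg_cong2[where f=emeasure]) (auto simp: space_pair_measure)
qed

text \<open>Given the first gap \<open>t\<close> of \<open>e\<close>, the event is again a box in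
  the remaining gaps. By memorylessness each other clock contributes the factor
  \<open>exp (- rate * t)\<close> and otherwise keeps its law, so only the integral of these factors
  over \<open>t\<close> remains.\<close>

lemma emeasure_restart_box:
  assumes e: "e \<in> clocks N" and J: "finite J" "J \<subseteq> clocks N \<times> UNIV"
    and A: "\<And>j. j \<in> J \<Longrightarrow> A j \<in> sets (gap_law N j)"
  defines "Q \<equiv> prod_emb (clocks N \<times> UNIV) (gap_law N) J (Pi\<^sub>E J A)"
  shows "emeasure (poisson_space N) {\<omega> \<in> space (poisson_space N). rings_first N e \<omega> \<and> restart N e \<omega> \<in> Q}
      = ennreal (event_rate N e / total_rate) * emeasure (poisson_space N) Q"
proof -
  \<comment> \<open>The box is padded with trivial sides so that \<open>J'\<close> contains the
    first gap of every clock, since ringing first constrains all of them. \<open>K\<close> marks the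
    gaps that get shortened.\<close>
  define A' where "A' j = (if j \<in> J then A j else UNIV)" for j
  define J' where "J' = J \<union> clocks N \<times> {0}"
  define K where "K = (clocks N - {e}) \<times> {0::nat}"
  define B where "B t j = (if j \<in> K then {s. t < s \<and> s - t \<in> A' j} else A' j)" for t j
  let ?R = "clocks N \<times> UNIV - {(e, 0)}"
  have A'[measurable]: "A' j \<in> sets borel" for j
    using A by (auto simp: A'_def)
  have B[measurable]: "B t j \<in> sets borel" for t j
    by (auto simp: B_def)
  have finJ': "finite J'" and J'I: "J' \<subseteq> clocks N \<times> UNIV" and KJ': "K \<subseteq> J'"
    using J finite_clocks by (auto simp: J'_def K_def)
  have [simp]: "finite K"
    using finite_clocks by (auto simp: K_def)
  have Q': "Q = prod_emb (clocks N \<times> UNIV) (gap_law N) J' (Pi\<^sub>E J' A')"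
  proof -
    have "(\<forall>j\<in>J. \<omega> j \<in> A j) \<longleftrightarrow> (\<forall>j\<in>J'. \<omega> j \<in> A' j)" for \<omega>
      using J by (auto simp: J'_def A'_def)
    then show ?thesis
      by (auto simp: Q_def prod_emb_def PiE_iff)
  qed
  have emQ: "emeasure (poisson_space N) Q = (\<Prod>j\<in>J'. emeasure (gap_law N j) (A' j))"
    unfolding Q' poisson_space_def using J'I finJ' A'
    by (intro emeasure_PiM_emb prob_space_gap_law) auto
  have Qs[measurable]: "Q \<in> sets (poisson_space N)"
    unfolding Q' poisson_space_def using J'I finJ' A' by (intro sets_PiM_I) auto
  \<comment> \<open>For fixed \<open>t\<close>, ringing first and landing in \<open>Q\<close>
    together become conditions on single coordinates, so the section is a cylinder and its measure a
    product.\<close>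
  have sec: "{X \<in> space (PiM ?R (gap_law N)). X((e, 0) := t) \<in>
        {\<omega> \<in> space (poisson_space N). rings_first N e \<omega> \<and> restart N e \<omega> \<in> Q}}
      = prod_emb ?R (gap_law N) (next_index e ` J') (Pi\<^sub>E (next_index e ` J') (B t \<circ> the_inv (next_index e)))" for t
  proof (intro set_eqI)
    fix X
    have upd: "X((e, 0) := t) \<in> space (poisson_space N)" if "X \<in> space (PiM ?R (gap_law N))"
      using that e by (auto simp: poisson_space_def space_PiM PiE_iff extensional_def)
    have rQ: "restart N e \<omega> \<in> Q \<longleftrightarrow> (\<forall>j\<in>J'. restart N e \<omega> j \<in> A' j)" for \<omega>
      using J'I unfolding Q' by (auto simp: prod_emb_def PiE_iff restart_def space_PiM)
    have main: "rings_first N e (X((e, 0) := t)) \<and> restart N e (X((e, 0) := t)) \<in> Q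
       \<longleftrightarrow> (\<forall>j\<in>J'. X (next_index e j) \<in> B t j)"
    proof -
      have "rings_first N e (X((e, 0) := t)) \<longleftrightarrow> (\<forall>j\<in>K. t < X (next_index e j))"
        by (auto simp: rings_first_def K_def next_index_def)
      moreover have "restart N e (X((e, 0) := t)) j = X (next_index e j) - (if j \<in> K then t else 0)"
        if "j \<in> J'" for j
        using that J'I next_index_neq[of e j] by (cases j) (auto simp: restart_def K_def)
      ultimately show ?thesis
        unfolding rQ using KJ' by (auto simp: B_def)
    qed
    show "X \<in> {X \<in> space (PiM ?R (gap_law N)). X((e, 0) := t) \<in>
        {\<omega> \<in> space (poisson_space N). rings_first N e \<omega> \<and> restart N e \<omega> \<in> Q}}
      \<longleftrightarrow> X \<in> prod_emb ?R (gap_law N) (next_index e ` J') (Pi\<^sub>E (next_index e ` J') (B t \<circ> the_inv (next_index e)))"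
    proof -
      have "X \<in> prod_emb ?R (gap_law N) (next_index e ` J') (Pi\<^sub>E (next_index e ` J') (B t \<circ> the_inv (next_index e)))
        \<longleftrightarrow> X \<in> space (PiM ?R (gap_law N)) \<and> (\<forall>j\<in>J'. X (next_index e j) \<in> B t j)"
        by (auto simp: prod_emb_def space_PiM PiE_iff the_inv_f_f[OF inj_next_index])
      then show ?thesis
        using main upd by auto
    qed
  qed
  have emB: "emeasure (gap_law N j) (B t j)
      = ennreal (if j \<in> K then exp (- event_rate N (fst j) * t) else 1) * emeasure (gap_law N j) (A' j)"
    if "0 \<le> t" "j \<in> J'" for t j
  proof -
    have "0 < event_rate N (fst j)"
      using that(2) J'I by (intro rate_pos) (auto simp: mem_Times_iff dest: subsetD)
    then show ?thesis
      using emeasure_exponential_shift[of "event_rate N (fst j)" t "A' j"] that(1) by (simp add: B_def)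
  qed
  have inner: "emeasure (PiM ?R (gap_law N)) {X \<in> space (PiM ?R (gap_law N)). X((e, 0) := t) \<in>
        {\<omega> \<in> space (poisson_space N). rings_first N e \<omega> \<and> restart N e \<omega> \<in> Q}}
     = ennreal (exp (- (total_rate - event_rate N e) * t)) * emeasure (poisson_space N) Q"
    if t: "0 \<le> t" for t
  proof -
    have "emeasure (PiM ?R (gap_law N)) {X \<in> space (PiM ?R (gap_law N)). X((e, 0) := t) \<in>
        {\<omega> \<in> space (poisson_space N). rings_first N e \<omega> \<and> restart N e \<omega> \<in> Q}}
      = (\<Prod>k\<in>next_index e ` J'. emeasure (gap_law N k) ((B t \<circ> the_inv (next_index e)) k))"
      unfolding sec using J'I finJ' next_index_neq[of e]
      by (intro emeasure_PiM_emb prob_space_gap_law) (auto simp: next_index_def)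
    also have "\<dots> = (\<Prod>j\<in>J'. emeasure (gap_law N j) (B t j))"
      using inj_next_index[of e]
      by (subst prod.reindex) (auto simp: inj_on_def inj_def the_inv_f_f)
    also have "\<dots> = (\<Prod>j\<in>J'. ennreal (if j \<in> K then exp (- event_rate N (fst j) * t) else 1))
        * (\<Prod>j\<in>J'. emeasure (gap_law N j) (A' j))"
      using t by (simp add: emB prod.distrib)
    also have "(\<Prod>j\<in>J'. ennreal (if j \<in> K then exp (- event_rate N (fst j) * t) else 1))
        = ennreal (\<Prod>j\<in>J'. if j \<in> K then exp (- event_rate N (fst j) * t) else 1)"
      by (intro prod_ennreal) auto
    also have "(\<Prod>j\<in>J'. if j \<in> K then exp (- event_rate N (fst j) * t) else 1)
        = (\<Prod>j\<in>K. exp (- event_rate N (fst j) * t))"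
      using finJ' KJ' by (simp add: prod.If_cases Int_absorb1)
    also have "\<dots> = exp (\<Sum>j\<in>K. - event_rate N (fst j) * t)"
      by (simp add: exp_sum)
    also have "(\<Sum>j\<in>K. - event_rate N (fst j) * t) = (\<Sum>e'\<in>clocks N - {e}. - event_rate N e' * t)"
      by (rule sum.reindex_bij_witness[where i="\<lambda>e'. (e', 0)" and j=fst]) (auto simp: K_def)
    also have "\<dots> = - (total_rate - event_rate N e) * t"
      using e finite_clocks
      by (simp add: sum_diff1 sum_negf sum_distrib_right[symmetric]) (simp add: algebra_simps)
    finally show ?thesis
      unfolding emQ .
  qed
  have "emeasure (poisson_space N) {\<omega> \<in> space (poisson_space N). rings_first N e \<omega> \<and> restart N e \<omega> \<in> Q}
    = (\<integral>\<^sup>+t. emeasure (PiM ?R (gap_law N)) {X \<in> space (PiM ?R (gap_law N)). X((e, 0) := t) \<in>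
        {\<omega> \<in> space (poisson_space N). rings_first N e \<omega> \<and> restart N e \<omega> \<in> Q}} \<partial>gap_law N (e, 0))"
    by (intro emeasure_poisson_space_split(1) sets_after_restart e Qs)
  also have "\<dots> = (\<integral>\<^sup>+t. ennreal (exp (- (total_rate - event_rate N e) * t))
      * emeasure (poisson_space N) Q \<partial>gap_law N (e, 0))"
  proof (rule nn_integral_cong_AE)
    have "AE t in gap_law N (e, 0). 0 \<le> t"
      by (subst AE_density) (auto simp: exponential_density_def intro!: AE_I2)
    then show "AE t in gap_law N (e, 0). emeasure (PiM ?R (gap_law N)) {X \<in> space (PiM ?R (gap_law N)).
       X((e, 0) := t) \<in> {\<omega> \<in> space (poisson_space N). rings_first N e \<omega> \<and> restart N e \<omega> \<in> Q}}
      = ennreal (exp (- (total_rate - event_rate N e) * t)) * emeasure (poisson_space N) Q"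
      by eventually_elim (rule inner)
  qed
  also have "\<dots> = (\<integral>\<^sup>+t. ennreal (exp (- (total_rate - event_rate N e) * t)) \<partial>gap_law N (e, 0))
      * emeasure (poisson_space N) Q"
    by (rule nn_integral_multc) simp
  also have "(\<integral>\<^sup>+t. ennreal (exp (- (total_rate - event_rate N e) * t)) \<partial>gap_law N (e, 0))
    = (\<integral>\<^sup>+t. ennreal (event_rate N e / total_rate) * ennreal (exponential_density total_rate t) \<partial>lborel)"
  proof -
    \<comment> \<open>The density of the first gap of \<open>e\<close>, times the probability that
      the other clocks are silent up to \<open>t\<close>, is a multiple of the density of the
      minimum of all first gaps.\<close>
    have "exponential_density (event_rate N e) t * exp (- (total_rate - event_rate N e) * t)
       = event_rate N e / total_rate * exponential_density total_rate t" for t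
      using total_rate_pos by (simp add: exponential_density_def exp_add[symmetric] algebra_simps)
    then show ?thesis
      using rate_pos[OF e] total_rate_pos
      by (subst nn_integral_density)
        (auto simp: ennreal_mult'[symmetric] exponential_density_nonneg intro!: nn_integral_cong)
  qed
  also have "\<dots> = ennreal (event_rate N e / total_rate)"
  proof -
    have "(\<integral>\<^sup>+t. ennreal (exponential_density total_rate t) \<partial>lborel) = 1"
      using prob_space.emeasure_space_1[OF prob_space_exponential_density[OF total_rate_pos]]
      by (simp add: emeasure_density)
    then show ?thesis
      by (simp add: nn_integral_cmult)
  qed
  finally show ?thesis .
qed

text \<open>The restarted law on the event that \<open>e\<close> rings first and the scaled original
  law are finite measures that agree on all boxes, hence are equal. This is the Markov property at
  the first ring.\<close>

lemma emeasure_restart: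
  assumes e: "e \<in> clocks N" and Q: "Q \<in> sets (poisson_space N)"
  shows "emeasure (poisson_space N) {\<omega> \<in> space (poisson_space N). rings_first N e \<omega> \<and> restart N e \<omega> \<in> Q}
      = ennreal (event_rate N e / total_rate) * emeasure (poisson_space N) Q"
proof -
  interpret P: prob_space "poisson_space N"
    by (rule prob_space_poisson_space)
  define F where "F = {\<omega> \<in> space (poisson_space N). rings_first N e \<omega>}"
  have F[measurable]: "F \<in> sets (poisson_space N)"
    unfolding F_def using e by measurable
  note [measurable] = measurable_restart[OF e]
  define \<mu> where "\<mu> = distr (restrict_space (poisson_space N) F) (poisson_space N) (restart N e)"
  have meas: "restart N e \<in> measurable (restrict_space (poisson_space N) F) (poisson_space N)"
    by (rule measurable_restrict_space1) measurable
  have em\<mu>: "emeasure \<mu> Q = emeasure (poisson_space N)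
      {\<omega> \<in> space (poisson_space N). rings_first N e \<omega> \<and> restart N e \<omega> \<in> Q}"
    if "Q \<in> sets (poisson_space N)" for Q
  proof -
    have "emeasure \<mu> Q = emeasure (restrict_space (poisson_space N) F)
        (restart N e -` Q \<inter> space (restrict_space (poisson_space N) F))"
      unfolding \<mu>_def using that meas by (simp add: emeasure_distr)
    also have "\<dots> = emeasure (poisson_space N)
        (restart N e -` Q \<inter> space (restrict_space (poisson_space N) F))"
      by (rule emeasure_restrict_space) (auto simp: space_restrict_space)
    also have "restart N e -` Q \<inter> space (restrict_space (poisson_space N) F)
        = {\<omega> \<in> space (poisson_space N). rings_first N e \<omega> \<and> restart N e \<omega> \<in> Q}"
      by (auto simp: space_restrict_space F_def)
    finally show ?thesis .
  qed
  have "\<mu> = scale_measure (ennreal (event_rate N e / total_rate)) (poisson_space N)"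
  proof (rule measure_eqI_PiM_infinite[where I="clocks N \<times> UNIV" and M="gap_law N"])
    show "sets \<mu> = sets (PiM (clocks N \<times> UNIV) (gap_law N))"
      by (simp add: \<mu>_def poisson_space_def)
    show "sets (scale_measure (ennreal (event_rate N e / total_rate)) (poisson_space N))
        = sets (PiM (clocks N \<times> UNIV) (gap_law N))"
      by (simp add: poisson_space_def)
    show "finite_measure \<mu>"
    proof (rule finite_measureI)
      have "emeasure \<mu> (space \<mu>) \<le> emeasure (poisson_space N) (space (poisson_space N))"
        by (subst em\<mu>) (auto simp: \<mu>_def intro!: emeasure_mono)
      then show "emeasure \<mu> (space \<mu>) \<noteq> \<infinity>"
        using P.emeasure_space_1 by (auto simp: top_unique)
    qed
  next
    fix A and J :: "('v event \<times> nat) set"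
    assume J: "finite J" "J \<subseteq> clocks N \<times> UNIV" "\<And>i. i \<in> J \<Longrightarrow> A i \<in> sets (gap_law N i)"
    then have "prod_emb (clocks N \<times> UNIV) (gap_law N) J (Pi\<^sub>E J A) \<in> sets (poisson_space N)"
      unfolding poisson_space_def by (intro sets_PiM_I) auto
    then show "emeasure \<mu> (prod_emb (clocks N \<times> UNIV) (gap_law N) J (Pi\<^sub>E J A)) =
       emeasure (scale_measure (ennreal (event_rate N e / total_rate)) (poisson_space N))
         (prod_emb (clocks N \<times> UNIV) (gap_law N) J (Pi\<^sub>E J A))"
      using emeasure_restart_box[OF e J(1,2), of A] J(3) by (simp add: em\<mu>)
  qed
  then show ?thesis
    using em\<mu>[OF Q] by simp
qed

end

section \<open>Sample paths\<close>

text \<open>On this event paths can be treated deterministically. Unbounded epochs keep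
  \<open>epochs_until\<close> finite (\<open>sorted_list_of_set\<close> of an infinite set is the
  empty list), and distinctness makes the choice in \<open>event_at\<close> unambiguous at
  epochs.\<close>

definition regular_gaps :: "'v network \<Rightarrow> ('v event \<times> nat \<Rightarrow> real) \<Rightarrow> bool" where
  "regular_gaps N \<omega> \<longleftrightarrow>
     (\<forall>e\<in>clocks N. (\<forall>n. 0 < \<omega> (e, n)) \<and> (\<forall>t. \<exists>n. t < epoch \<omega> e n)
        \<and> (\<forall>e'\<in>clocks N. e \<noteq> e' \<longrightarrow> (\<forall>n m. epoch \<omega> e n \<noteq> epoch \<omega> e' m)))"

lemma epoch_0 [simp]: "epoch \<omega> e 0 = \<omega> (e, 0)"
  by (simp add: epoch_def)

lemma epoch_Suc: "epoch \<omega> e (Suc n) = epoch \<omega> e n + \<omega> (e, Suc n)"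
  by (simp add: epoch_def)

lemma strict_mono_epoch:
  assumes "\<And>n. 0 < \<omega> (e, n)"
  shows "strict_mono (epoch \<omega> e)"
  using assms by (simp add: strict_mono_Suc_iff epoch_Suc)

text \<open>Beyond every index some gap exceeds 1, and each such gap lifts the epochs past one more
  natural number.\<close>

lemma epoch_unbounded:
  assumes pos: "\<And>n. 0 < \<omega> (e, n)" and large: "\<And>n. \<exists>k\<ge>n. 1 < \<omega> (e, k)"
  shows "\<exists>n. t < epoch \<omega> e n"
proof -
  have "\<exists>n. real m < epoch \<omega> e n" for m :: nat
  proof (induction m)
    case 0
    have "0 < epoch \<omega> e 0"
      using pos by simp
    then show ?case
      by (metis of_nat_0)
  next
    case (Suc m)
    then obtain n where n: "real m < epoch \<omega> e n"
      by auto
    obtain k where k: "Suc n \<le> k" "1 < \<omega> (e, k)"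
      using large by blast
    obtain k' where k': "k = Suc k'" "n \<le> k'"
      using k(1) by (cases k) auto
    have "strict_mono (epoch \<omega> e)"
      by (rule strict_mono_epoch) (rule pos)
    then have "epoch \<omega> e n \<le> epoch \<omega> e k'"
      using k'(2) by (simp add: strict_mono_less_eq)
    then have "real (Suc m) < epoch \<omega> e k"
      using n k k'(1) by (simp add: epoch_Suc)
    then show ?case
      by blast
  qed
  then show ?thesis
    by (metis reals_Archimedean2 order_less_trans)
qed

lemma regular_gaps_strict_mono: "regular_gaps N \<omega> \<Longrightarrow> e \<in> clocks N \<Longrightarrow> strict_mono (epoch \<omega> e)"
  by (rule strict_mono_epoch) (simp add: regular_gaps_def)

lemma regular_gaps_epoch_ge: "regular_gaps N \<omega> \<Longrightarrow> e \<in> clocks N \<Longrightarrow> \<omega> (e, 0) \<le> epoch \<omega> e n"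
  using strict_mono_less_eq[OF regular_gaps_strict_mono, of N \<omega> e 0 n] by simp

lemma regular_gaps_unbounded: "regular_gaps N \<omega> \<Longrightarrow> e \<in> clocks N \<Longrightarrow> \<exists>n. t < epoch \<omega> e n"
  by (simp add: regular_gaps_def)

lemma rings_first_le: "rings_first N e \<omega> \<Longrightarrow> e' \<in> clocks N \<Longrightarrow> \<omega> (e, 0) \<le> \<omega> (e', 0)"
  by (cases "e' = e") (auto simp: rings_first_def intro: less_imp_le)

text \<open>For \<open>e\<close> itself the index moves by one, because its first ring has been
  consumed. For the other clocks only the origin of time moves: the elapsed time is subtracted once,
  in the first gap.\<close>

lemma epoch_restart_same:
  "e \<in> clocks N \<Longrightarrow> epoch (restart N e \<omega>) e n = epoch \<omega> e (Suc n) - \<omega> (e, 0)"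
  unfolding epoch_def sum.atMost_Suc_shift[of _ n]
  by (simp add: restart_def next_index_def)

lemma epoch_restart_other:
  "e' \<in> clocks N \<Longrightarrow> e' \<noteq> e \<Longrightarrow> epoch (restart N e \<omega>) e' n = epoch \<omega> e' n - \<omega> (e, 0)"
  by (induction n) (auto simp: epoch_Suc restart_def next_index_def)

lemma regular_gaps_restart:
  assumes reg: "regular_gaps N \<omega>" and e: "e \<in> clocks N" and first: "rings_first N e \<omega>"
  shows "regular_gaps N (restart N e \<omega>)"
proof -
  have shift: "\<exists>m. epoch (restart N e \<omega>) e' n = epoch \<omega> e' m - \<omega> (e, 0)" if "e' \<in> clocks N" for e' n
    using that epoch_restart_same[OF e] epoch_restart_other by metis
  have pos: "0 < restart N e \<omega> (e', n)" if "e' \<in> clocks N" for e' n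
    using that reg e first by (auto simp: restart_def next_index_def regular_gaps_def rings_first_def)
  have unb: "\<exists>n. t < epoch (restart N e \<omega>) e' n" if e': "e' \<in> clocks N" for e' t
  proof -
    obtain n where "t + \<omega> (e, 0) < epoch \<omega> e' n"
      using regular_gaps_unbounded[OF reg e'] by blast
    with regular_gaps_strict_mono[OF reg e'] have "t + \<omega> (e, 0) < epoch \<omega> e' n" "t + \<omega> (e, 0) < epoch \<omega> e' (Suc n)"
      using strict_monoD[of "epoch \<omega> e'" n "Suc n"] by auto
    then show ?thesis
      using epoch_restart_same[OF e, of \<omega> n] epoch_restart_other[OF e', of e \<omega> n]
      by (cases "e' = e") (auto intro!: exI[of _ n])
  qed
  have "epoch (restart N e \<omega>) e1 n \<noteq> epoch (restart N e \<omega>) e2 m"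
    if "e1 \<in> clocks N" "e2 \<in> clocks N" "e1 \<noteq> e2" for e1 e2 n m
    using shift[OF that(1), of n] shift[OF that(2), of m] that reg
    by (auto simp: regular_gaps_def)
  with pos unb show ?thesis
    by (simp add: regular_gaps_def)
qed

lemma state_at_before:
  assumes reg: "regular_gaps N \<omega>" and first: "rings_first N e \<omega>" and t: "t < \<omega> (e, 0)"
  shows "state_at D N x \<omega> t = x" and "epochs_until N \<omega> t = {}"
proof -
  have "\<not> epoch \<omega> e' n \<le> t" if e': "e' \<in> clocks N" for e' n
    using t rings_first_le[OF first e'] regular_gaps_epoch_ge[OF reg e', of n] by simp
  then show "epochs_until N \<omega> t = {}"
    by (auto simp: epochs_until_def)
  then show "state_at D N x \<omega> t = x"
    by (simp add: state_at_def)
qed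

context finite_clocks
begin

lemma finite_epochs_until:
  assumes "regular_gaps N \<omega>"
  shows "finite (epochs_until N \<omega> t)"
proof -
  have "finite {n. epoch \<omega> e n \<le> t}" if e: "e \<in> clocks N" for e
  proof -
    obtain m where m: "t < epoch \<omega> e m"
      using regular_gaps_unbounded[OF assms e] by blast
    have "{n. epoch \<omega> e n \<le> t} \<subseteq> {..<m}"
      using m strict_mono_less[OF regular_gaps_strict_mono[OF assms e]] by (auto intro: le_less_trans)
    then show ?thesis
      by (rule finite_subset) simp
  qed
  then have "finite (\<Union>e\<in>clocks N. epoch \<omega> e ` {n. epoch \<omega> e n \<le> t})"
    using finite_clocks by auto
  then show ?thesis
    by (rule rev_finite_subset) (auto simp: epochs_until_def)
qed

lemma ex_rings_first:
  assumes "regular_gaps N \<omega>"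
  shows "\<exists>e\<in>clocks N. rings_first N e \<omega>"
proof -
  obtain e where e: "e \<in> clocks N" "\<And>e'. e' \<in> clocks N \<Longrightarrow> \<omega> (e, 0) \<le> \<omega> (e', 0)"
    using ex_is_arg_min_if_finite[OF finite_clocks clocks_nonempty, of "\<lambda>e. \<omega> (e, 0)"]
    by (auto simp: is_arg_min_linorder)
  have "\<omega> (e, 0) \<noteq> \<omega> (e', 0)" if "e' \<in> clocks N - {e}" for e'
    using assms that e(1) epoch_0 unfolding regular_gaps_def by (metis DiffD1 DiffD2 singletonI)
  then show ?thesis
    using e by (force simp: rings_first_def intro!: bexI[of _ e])
qed

text \<open>The epochs up to \<open>t\<close> are the first ring followed by a translate of the
  restarted epochs, so the fold peels off one event. The cardinality claim makes the number of rings
  available as an induction parameter.\<close>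

lemma
  assumes reg: "regular_gaps N \<omega>" and e: "e \<in> clocks N" and first: "rings_first N e \<omega>"
    and t: "\<omega> (e, 0) \<le> t"
  shows state_at_after:
      "state_at D N x \<omega> t = state_at D N (event_step D N e x) (restart N e \<omega>) (t - \<omega> (e, 0))"
    and card_epochs_until_after:
      "card (epochs_until N \<omega> t) = Suc (card (epochs_until N (restart N e \<omega>) (t - \<omega> (e, 0))))"
proof -
  let ?T = "\<omega> (e, 0)" and ?\<omega> = "restart N e \<omega>"
  define S where "S = epochs_until N ?\<omega> (t - ?T)"
  define L where "L = sorted_list_of_set S"
  have reg': "regular_gaps N ?\<omega>"
    by (rule regular_gaps_restart[OF reg e first])
  have [simp]: "finite S"
    unfolding S_def by (rule finite_epochs_until[OF reg'])
  \<comment> \<open>Strict positivity makes the first ring the head of the sorted list and keeps it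
    out of the translated set.\<close>
  have Spos: "0 < s" if sS: "s \<in> S" for s
  proof -
    obtain e' n where e': "e' \<in> clocks N" and s: "s = epoch ?\<omega> e' n"
      using sS by (auto simp: S_def epochs_until_def)
    moreover have "0 < ?\<omega> (e', 0)"
      using reg' e' by (simp add: regular_gaps_def)
    ultimately show ?thesis
      using regular_gaps_epoch_ge[OF reg' e', of n] by simp
  qed
  have same: "(\<exists>n. ?T + s = epoch \<omega> e' n) \<longleftrightarrow> (\<exists>n. s = epoch ?\<omega> e' n)"
    if "e' \<in> clocks N" "0 < s" for e' s
  proof (cases "e' = e")
    case True
    \<comment> \<open>Index 0 would give \<open>s = 0\<close>, so only successor indices remain,
      matching the index shift of the restart.\<close>
    have "(\<exists>n. ?T + s = epoch \<omega> e n) \<longleftrightarrow> (\<exists>n. ?T + s = epoch \<omega> e (Suc n))"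
      using that(2) by (metis epoch_0 less_add_same_cancel1 less_irrefl not0_implies_Suc)
    then show ?thesis
      using True by (simp add: epoch_restart_same[OF e] eq_diff_eq add.commute)
  next
    case False
    then show ?thesis
      by (simp add: epoch_restart_other[OF that(1)] eq_diff_eq add.commute)
  qed
  have until: "epochs_until N \<omega> t = insert ?T ((+) ?T ` S)"
  proof (intro set_eqI iffI)
    fix s assume "s \<in> epochs_until N \<omega> t"
    then obtain e' n where s: "s \<le> t" "e' \<in> clocks N" "s = epoch \<omega> e' n"
      by (auto simp: epochs_until_def)
    have "?T \<le> s"
      using rings_first_le[OF first s(2)] regular_gaps_epoch_ge[OF reg s(2), of n] s(3) by simp
    show "s \<in> insert ?T ((+) ?T ` S)"
    proof (cases "s = ?T")
      case False
      with \<open>?T \<le> s\<close> have "0 < s - ?T"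
        by simp
      with same[OF s(2) this] s have "s - ?T \<in> S"
        by (auto simp: S_def epochs_until_def)
      then show ?thesis
        by (auto intro!: image_eqI[of _ _ "s - ?T"])
    qed simp
  next
    fix s assume "s \<in> insert ?T ((+) ?T ` S)"
    then consider "s = ?T" | s' where "s' \<in> S" "s = ?T + s'"
      by auto
    then show "s \<in> epochs_until N \<omega> t"
    proof cases
      case 1
      then show ?thesis
        using t e by (auto simp: epochs_until_def intro!: bexI[of _ e] exI[of _ 0])
    next
      case 2
      then show ?thesis
        using same[OF _ Spos[OF 2(1)]] by (force simp: S_def epochs_until_def)
    qed
  qed
  have "?T \<notin> (+) ?T ` S"
    using Spos by force
  then show "card (epochs_until N \<omega> t) = Suc (card (epochs_until N ?\<omega> (t - ?T)))"
    unfolding until S_def[symmetric] by (simp add: card_image)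
  have "sorted (?T # map ((+) ?T) L)" "distinct (?T # map ((+) ?T) L)"
    using Spos \<open>?T \<notin> (+) ?T ` S\<close> sorted_sorted_list_of_set[of S]
    by (auto simp: L_def sorted_map distinct_map less_imp_le)
  then have "sorted_list_of_set (set (?T # map ((+) ?T) L)) = ?T # map ((+) ?T) L"
    by (rule sorted_list_of_set.idem_if_sorted_distinct)
  then have list: "sorted_list_of_set (epochs_until N \<omega> t) = ?T # map ((+) ?T) L"
    unfolding until by (simp add: L_def)
  have at_T: "event_at N \<omega> ?T = e"
    unfolding event_at_def
  proof (rule some_equality)
    show "e \<in> clocks N \<and> (\<exists>n. ?T = epoch \<omega> e n)"
      using e epoch_0 by metis
    show "e' = e" if "e' \<in> clocks N \<and> (\<exists>n. ?T = epoch \<omega> e' n)" for e'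
      using that reg e epoch_0 unfolding regular_gaps_def by metis
  qed
  \<comment> \<open>The predicates under the two choice operators are equal, so the chosen events
    are equal.\<close>
  have "event_at N \<omega> (?T + s) = event_at N ?\<omega> s" if "s \<in> S" for s
    unfolding event_at_def using same[OF _ Spos[OF that]] by metis
  then have "fold (\<lambda>s. event_step D N (event_at N \<omega> (?T + s))) L y
      = fold (\<lambda>s. event_step D N (event_at N ?\<omega> s)) L y" for y
    by (intro fold_cong) (auto simp: L_def)
  then show "state_at D N x \<omega> t = state_at D N (event_step D N e x) ?\<omega> (t - ?T)"
    unfolding state_at_def list S_def[symmetric] L_def[symmetric]
    by (simp add: at_T fold_map comp_def)
qed

section \<open>Almost sure regularity of the gaps\<close>

lemma AE_gap_pos:
  assumes "e \<in> clocks N"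
  shows "AE \<omega> in poisson_space N. 0 < \<omega> (e, n)"
  unfolding poisson_space_def
proof (rule AE_PiM_component[OF prob_space_gap_law])
  have "AE x in lborel. 0 < exponential_density (event_rate N e) x \<longrightarrow> 0 < x"
    using AE_lborel_singleton[of 0] by eventually_elim (auto simp: exponential_density_def)
  then show "AE x in gap_law N (e, n). 0 < x"
    by (simp add: AE_density)
qed (use assms in auto)

lemma measurable_epoch [measurable]:
  "e \<in> clocks N \<Longrightarrow> (\<lambda>\<omega>. epoch \<omega> e n) \<in> borel_measurable (poisson_space N)"
  unfolding epoch_def by (intro borel_measurable_sum measurable_coordinate) auto

text \<open>A tail of gaps that are all at most 1 lies, for every \<open>m\<close>, in a box over
  \<open>m\<close> independent coordinates of probability \<open>q ^ m\<close>, where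
  \<open>q < 1\<close> because the exponential law charges the values above 1.\<close>

lemma AE_large_gap:
  assumes e: "e \<in> clocks N"
  shows "AE \<omega> in poisson_space N. \<exists>k\<ge>n. 1 < \<omega> (e, k)"
proof -
  interpret P: prob_space "poisson_space N"
    by (rule prob_space_poisson_space)
  interpret E: prob_space "gap_law N (e, 0)"
    using e by (intro prob_space_gap_law) auto
  define Z where "Z = {\<omega> \<in> space (poisson_space N). \<forall>k\<ge>n. \<omega> (e, k) \<le> 1}"
  have [measurable]: "(\<lambda>\<omega>. \<omega> (e, k)) \<in> borel_measurable (poisson_space N)" for k
    using e by simp
  have Z[measurable]: "Z \<in> sets (poisson_space N)"
    unfolding Z_def by measurable
  let ?q = "E.prob {..1}"
  have "P.prob Z \<le> ?q ^ m" for m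
  proof -
    let ?J = "{e} \<times> {n..<n + m}"
    have box: "prod_emb (clocks N \<times> UNIV) (gap_law N) ?J (Pi\<^sub>E ?J (\<lambda>_. {..1})) \<in> sets (poisson_space N)"
      unfolding poisson_space_def using e by (intro sets_PiM_I) auto
    have "P.prob Z \<le> P.prob (prod_emb (clocks N \<times> UNIV) (gap_law N) ?J (Pi\<^sub>E ?J (\<lambda>_. {..1})))"
    proof (rule P.finite_measure_mono[OF _ box])
      show "Z \<subseteq> prod_emb (clocks N \<times> UNIV) (gap_law N) ?J (Pi\<^sub>E ?J (\<lambda>_. {..1}))"
        by (auto simp: Z_def prod_emb_def PiE_iff poisson_space_def space_PiM extensional_def)
    qed
    also have "\<dots> = (\<Prod>j\<in>?J. E.prob {..1})"
    proof -
      have "emeasure (poisson_space N) (prod_emb (clocks N \<times> UNIV) (gap_law N) ?J (Pi\<^sub>E ?J (\<lambda>_. {..1})))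
          = (\<Prod>j\<in>?J. emeasure (gap_law N j) {..1})"
        unfolding poisson_space_def using e by (intro emeasure_PiM_emb prob_space_gap_law) auto
      also have "\<dots> = (\<Prod>j\<in>?J. ennreal (E.prob {..1}))"
        using E.emeasure_eq_measure[of "{..1}"] by (intro prod.cong) auto
      also have "\<dots> = ennreal (\<Prod>j\<in>?J. E.prob {..1})"
        by (intro prod_ennreal) auto
      finally show ?thesis
        by (simp add: measure_def prod_nonneg)
    qed
    also have "\<dots> = ?q ^ m"
      by (simp add: card_cartesian_product)
    finally show ?thesis .
  qed
  moreover have "(\<lambda>m. ?q ^ m) \<longlonglongrightarrow> 0"
  proof (rule LIMSEQ_power_zero)
    \<comment> \<open>The tail probability is the shift identity applied to the whole line.\<close>
    have "emeasure (gap_law N (e, 0)) {1<..} = ennreal (exp (- event_rate N e))"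
      using emeasure_exponential_shift[of "event_rate N e" 1 UNIV] rate_pos[OF e] E.emeasure_space_1
      by (simp add: greaterThan_def)
    then have "E.prob {1<..} = exp (- event_rate N e)"
      by (simp add: measure_def)
    moreover have "{..1} = space (gap_law N (e, 0)) - {1<..}"
      by auto
    ultimately have "?q < 1"
      using E.prob_compl[of "{1<..}"] by simp
    then show "norm ?q < 1"
      by simp
  qed
  ultimately have "P.prob Z \<le> 0"
    by (intro LIMSEQ_le_const[of _ 0]) auto
  then have "Z \<in> null_sets (poisson_space N)"
    by (simp add: P.emeasure_eq_measure null_sets_def measure_le_0_iff)
  then show ?thesis
    by (rule AE_I') (auto simp: Z_def not_less)
qed

text \<open>With all other gaps frozen, an epoch of \<open>e\<close> is the first gap of
  \<open>e\<close> plus a constant, and an epoch of \<open>e'\<close> is constant. A coincidence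
  thus pins that gap to one point, which is null for a law with a density.\<close>

lemma AE_epoch_neq:
  assumes e: "e \<in> clocks N" and e': "e' \<in> clocks N" "e \<noteq> e'"
  shows "AE \<omega> in poisson_space N. epoch \<omega> e n \<noteq> epoch \<omega> e' m"
proof -
  define Z where "Z = {\<omega> \<in> space (poisson_space N). epoch \<omega> e n = epoch \<omega> e' m}"
  have Z: "Z \<in> sets (poisson_space N)"
    unfolding Z_def using e e' by measurable
  have "emeasure (gap_law N (e, 0)) {t. X((e, 0) := t) \<in> Z} = 0" for X
  proof -
    have "epoch (X((e, 0) := t)) e n = t + (epoch X e n - X (e, 0))" for t
      by (induction n) (auto simp: epoch_Suc)
    moreover have "epoch (X((e, 0) := t)) e' m = epoch X e' m" for t
      using e'(2) by (auto simp: epoch_def)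
    ultimately have "{t. X((e, 0) := t) \<in> Z} \<subseteq> {epoch X e' m - (epoch X e n - X (e, 0))}"
      by (auto simp: Z_def)
    moreover have "{c} \<in> null_sets (gap_law N (e, 0))" for c
    proof -
      have "AE x in lborel. x \<in> {c} \<longrightarrow> ennreal (exponential_density (event_rate N e) x) = 0"
        using AE_lborel_singleton[of c] by eventually_elim simp
      then show ?thesis
        by (subst null_sets_density_iff) simp_all
    qed
    ultimately show ?thesis
      by (metis emeasure_mono null_setsD1 null_setsD2 le_zero_eq)
  qed
  then have "emeasure (poisson_space N) Z = 0"
    using emeasure_poisson_space_split(2)[OF e Z] by simp
  then have "Z \<in> null_sets (poisson_space N)"
    using Z by (simp add: null_sets_def)
  then show ?thesis
    by (rule AE_I') (auto simp: Z_def)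
qed

lemma AE_regular_gaps: "AE \<omega> in poisson_space N. regular_gaps N \<omega>"
proof -
  have cnt: "countable (clocks N)"
    using finite_clocks by (rule countable_finite)
  have "AE \<omega> in poisson_space N. \<forall>e\<in>clocks N. (\<forall>n. 0 < \<omega> (e, n)) \<and> (\<forall>n. \<exists>k\<ge>n. 1 < \<omega> (e, k))
      \<and> (\<forall>e'\<in>clocks N. e \<noteq> e' \<longrightarrow> (\<forall>n m. epoch \<omega> e n \<noteq> epoch \<omega> e' m))"
    using AE_gap_pos AE_large_gap AE_epoch_neq
    by (simp add: AE_ball_countable[OF cnt] AE_all_countable)
  then show ?thesis
    by eventually_elim (auto simp: regular_gaps_def intro!: epoch_unbounded)
qed

end

section \<open>A criterion for transience\<close>

text \<open>Hitting \<open>y\<close> within \<open>n\<close> rings, where rings that leave the state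
  unchanged count as well. Recursion on restarts, instead of a formulation through
  \<open>state_at\<close>, gives measurability and the one-step estimate by induction on
  \<open>n\<close>.\<close>

fun visits_within :: "'v discipline \<Rightarrow> 'v network \<Rightarrow> 'v state \<Rightarrow> nat \<Rightarrow> 'v state
    \<Rightarrow> ('v event \<times> nat \<Rightarrow> real) \<Rightarrow> bool" where
  "visits_within D N y 0 x \<omega> \<longleftrightarrow> x = y"
| "visits_within D N y (Suc n) x \<omega> \<longleftrightarrow> x = y \<or>
     (\<exists>e\<in>clocks N. rings_first N e \<omega> \<and> visits_within D N y n (event_step D N e x) (restart N e \<omega>))"

lemma visits_within_Suc: "visits_within D N y n x \<omega> \<Longrightarrow> visits_within D N y (Suc n) x \<omega>"
proof (induction n arbitrary: x \<omega>)
  case (Suc n)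
  then show ?case
    by (subst visits_within.simps(2)) (force simp del: visits_within.simps(2) simp: visits_within.simps(2)[of D N y n x \<omega>])
qed simp

context finite_clocks
begin

text \<open>The bridge from continuous time to the recursion, used in contraposition: a path that
  never visits \<open>y\<close> in the recursive sense is at \<open>y\<close> at no time.\<close>

lemma state_at_visits_within:
  assumes "regular_gaps N \<omega>" "state_at D N x \<omega> t = y"
  shows "visits_within D N y (card (epochs_until N \<omega> t)) x \<omega>"
  using assms
proof (induction "card (epochs_until N \<omega> t)" arbitrary: x \<omega> t)
  case 0
  obtain e where e: "e \<in> clocks N" "rings_first N e \<omega>"
    using ex_rings_first 0 by blast
  then have "t < \<omega> (e, 0)"
    using card_epochs_until_after[OF 0(2) e, of t] 0(1) by force
  then have "x = y"
    using state_at_before(1)[OF 0(2) e(2)] 0 by metis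
  then show ?case
    using 0(1) by (metis visits_within.simps(1))
next
  case (Suc n)
  obtain e where e: "e \<in> clocks N" "rings_first N e \<omega>"
    using ex_rings_first Suc by blast
  have t: "\<omega> (e, 0) \<le> t"
    using state_at_before(2)[OF Suc(3) e(2), of t] Suc(2) by force
  have card: "n = card (epochs_until N (restart N e \<omega>) (t - \<omega> (e, 0)))"
    using card_epochs_until_after[OF Suc(3) e t] Suc(2) by simp
  have "visits_within D N y n (event_step D N e x) (restart N e \<omega>)"
    using Suc(1)[OF card regular_gaps_restart[OF Suc(3) e]] Suc(4) state_at_after[OF Suc(3) e t, of D x] card
    by simp
  then have "visits_within D N y (Suc n) x \<omega>"
    using e by auto
  then show ?case
    unfolding Suc(2) .
qed

lemma measurable_visits_within [measurable]:
  "Measurable.pred (poisson_space N) (visits_within D N y n x)"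
proof (induction n arbitrary: x)
  case 0
  then show ?case
    by (simp add: visits_within.simps(1)[abs_def])
next
  case (Suc n)
  have "Measurable.pred (poisson_space N)
     (\<lambda>\<omega>. rings_first N e \<omega> \<and> visits_within D N y n (event_step D N e x) (restart N e \<omega>))"
    if "e \<in> clocks N" for e
    using that measurable_compose[OF measurable_restart[OF that] Suc[of "event_step D N e x"]]
    by (intro pred_intros_logic measurable_rings_first) auto
  then show ?case
    using finite_clocks by (auto intro!: pred_intros_logic pred_intros_finite simp: visits_within.simps(2)[abs_def])
qed

text \<open>A maximal inequality: \<open>h\<close> along the embedded chain stopped at
  \<open>y\<close> is a nonnegative supermartingale, and it is at least 1 once \<open>y\<close> is
  hit. The induction conditions on the clock that rings first, using the restart identity, and then
  applies superharmonicity.\<close>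

lemma visits_within_prob_le:
  fixes h :: "'v state \<Rightarrow> real"
  assumes closed: "\<And>x e. x \<in> S \<Longrightarrow> e \<in> clocks N \<Longrightarrow> event_step D N e x \<in> S"
    and h0: "\<And>x. 0 \<le> h x" and hy: "1 \<le> h y"
    and super: "\<And>x. x \<in> S \<Longrightarrow> x \<noteq> y \<Longrightarrow>
      (\<Sum>e\<in>clocks N. event_rate N e * h (event_step D N e x)) \<le> total_rate * h x"
    and x: "x \<in> S"
  shows "emeasure (poisson_space N) {\<omega> \<in> space (poisson_space N). visits_within D N y n x \<omega>} \<le> ennreal (h x)"
proof -
  interpret P: prob_space "poisson_space N"
    by (rule prob_space_poisson_space)
  have hit: "emeasure (poisson_space N) A \<le> ennreal (h y)" for A
    using P.emeasure_le_1[of A] hy by (intro order_trans[OF P.emeasure_le_1]) (simp add: ennreal_leI flip: ennreal_1)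
  show ?thesis
    using x
  proof (induction n arbitrary: x)
    case 0
    then show ?case
      using hit by (cases "x = y") auto
  next
    case (Suc n)
    show ?case
    proof (cases "x = y")
      case False
      let ?V = "\<lambda>e. {\<omega> \<in> space (poisson_space N). visits_within D N y n (event_step D N e x) \<omega>}"
      let ?R = "\<lambda>e. {\<omega> \<in> space (poisson_space N). rings_first N e \<omega> \<and> restart N e \<omega> \<in> ?V e}"
      have V: "?V e \<in> sets (poisson_space N)" for e
        by measurable
      have R: "?R e \<in> sets (poisson_space N)" if "e \<in> clocks N" for e
        by (rule sets_after_restart[OF that V])
      have "{\<omega> \<in> space (poisson_space N). visits_within D N y (Suc n) x \<omega>} = (\<Union>e\<in>clocks N. ?R e)"
        using False measurable_space[OF measurable_restart] by auto
      then have "emeasure (poisson_space N) {\<omega> \<in> space (poisson_space N). visits_within D N y (Suc n) x \<omega>}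
          \<le> (\<Sum>e\<in>clocks N. emeasure (poisson_space N) (?R e))"
        using R finite_clocks by (auto intro!: emeasure_subadditive_finite)
      also have "\<dots> = (\<Sum>e\<in>clocks N. ennreal (event_rate N e / total_rate) * emeasure (poisson_space N) (?V e))"
        by (intro sum.cong refl emeasure_restart V)
      also have "\<dots> \<le> (\<Sum>e\<in>clocks N. ennreal (event_rate N e / total_rate) * ennreal (h (event_step D N e x)))"
        using Suc closed by (intro sum_mono mult_left_mono) auto
      also have "\<dots> = ennreal (\<Sum>e\<in>clocks N. event_rate N e / total_rate * h (event_step D N e x))"
      proof -
        have nonneg: "0 \<le> event_rate N e / total_rate" if "e \<in> clocks N" for e
          using rate_pos[OF that] total_rate_pos by simp
        then have "(\<Sum>e\<in>clocks N. ennreal (event_rate N e / total_rate) * ennreal (h (event_step D N e x)))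
            = (\<Sum>e\<in>clocks N. ennreal (event_rate N e / total_rate * h (event_step D N e x)))"
          using h0 by (intro sum.cong refl ennreal_mult[symmetric])
        also have "\<dots> = ennreal (\<Sum>e\<in>clocks N. event_rate N e / total_rate * h (event_step D N e x))"
          using nonneg h0 by (intro sum_ennreal mult_nonneg_nonneg)
        finally show ?thesis .
      qed
      also have "\<dots> \<le> ennreal (h x)"
        using super[OF Suc.prems False] total_rate_pos
        by (intro ennreal_leI) (simp add: sum_divide_distrib[symmetric] pos_divide_le_eq mult.commute)
      finally show ?thesis .
    qed (use hit in auto)
  qed
qed

text \<open>The bound \<open>h x\<close> does not depend on the horizon \<open>n\<close>, and the
  events increase with \<open>n\<close>, so the bound passes to their union. As
  \<open>h x < 1\<close>, the complement keeps positive mass.\<close>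

lemma never_visits_pos:
  fixes h :: "'v state \<Rightarrow> real"
  assumes closed: "\<And>x e. x \<in> S \<Longrightarrow> e \<in> clocks N \<Longrightarrow> event_step D N e x \<in> S"
    and h0: "\<And>x. 0 \<le> h x" and hy: "1 \<le> h y"
    and super: "\<And>x. x \<in> S \<Longrightarrow> x \<noteq> y \<Longrightarrow>
      (\<Sum>e\<in>clocks N. event_rate N e * h (event_step D N e x)) \<le> total_rate * h x"
    and x: "x \<in> S" "h x < 1"
  shows "0 < emeasure (poisson_space N) {\<omega> \<in> space (poisson_space N). \<forall>n. \<not> visits_within D N y n x \<omega>}"
proof -
  interpret P: prob_space "poisson_space N"
    by (rule prob_space_poisson_space)
  let ?V = "\<lambda>n. {\<omega> \<in> space (poisson_space N). visits_within D N y n x \<omega>}"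
  have "(SUP n. emeasure (poisson_space N) (?V n)) = emeasure (poisson_space N) (\<Union>n. ?V n)"
    by (intro SUP_emeasure_incseq) (auto simp: incseq_Suc_iff dest: visits_within_Suc simp del: visits_within.simps)
  moreover have "(SUP n. emeasure (poisson_space N) (?V n)) \<le> ennreal (h x)"
    by (intro SUP_least visits_within_prob_le[OF closed h0 hy super x(1)])
  ultimately have "emeasure (poisson_space N) (\<Union>n. ?V n) < 1"
    using x(2) by (auto simp: ennreal_less_one_iff intro: le_less_trans[of _ "ennreal (h x)"])
  moreover have "emeasure (poisson_space N) (space (poisson_space N) - (\<Union>n. ?V n))
      = 1 - emeasure (poisson_space N) (\<Union>n. ?V n)"
    by (subst emeasure_compl) (auto simp: P.emeasure_space_1)
  moreover have "space (poisson_space N) - (\<Union>n. ?V n)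
      = {\<omega> \<in> space (poisson_space N). \<forall>n. \<not> visits_within D N y n x \<omega>}"
    by auto
  ultimately show ?thesis
    by (simp add: diff_gr0_ennreal)
qed

text \<open>Foster's criterion for transience, for the embedded jump chain.\<close>

lemma not_positive_recurrent_state:
  fixes h :: "'v state \<Rightarrow> real"
  assumes closed: "\<And>x e. x \<in> S \<Longrightarrow> e \<in> clocks N \<Longrightarrow> event_step D N e x \<in> S"
    and h0: "\<And>x. 0 \<le> h x" and hy: "1 \<le> h y"
    and super: "\<And>x. x \<in> S \<Longrightarrow> x \<noteq> y \<Longrightarrow>
      (\<Sum>e\<in>clocks N. event_rate N e * h (event_step D N e x)) \<le> total_rate * h x"
    and y: "y \<in> S" and e: "e \<in> clocks N" and hx: "h (event_step D N e y) < 1"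
  shows "\<not> positive_recurrent_state D N y"
proof -
  define x where "x = event_step D N e y"
  define G where "G = {\<omega> \<in> space (poisson_space N). \<forall>n. \<not> visits_within D N y n x \<omega>}"
  \<comment> \<open>On \<open>E\<close> the path sits at \<open>y\<close> until \<open>e\<close>
    rings, jumps to \<open>x\<close>, and never meets \<open>y\<close> again. By the restart
    identity \<open>E\<close> inherits positive probability from \<open>G\<close>.\<close>
  define E where "E = {\<omega> \<in> space (poisson_space N). rings_first N e \<omega> \<and> restart N e \<omega> \<in> G}"
  have G[measurable]: "G \<in> sets (poisson_space N)"
    unfolding G_def by measurable
  have E: "E \<in> sets (poisson_space N)"
    unfolding E_def by (rule sets_after_restart[OF e G])
  have "x \<in> S" "x \<noteq> y"
    using closed[OF y e] hx hy by (auto simp: x_def)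
  have "0 < emeasure (poisson_space N) G"
    unfolding G_def using never_visits_pos[OF closed h0 hy super \<open>x \<in> S\<close>] hx by (simp add: x_def)
  then have Epos: "0 < emeasure (poisson_space N) E"
    unfolding E_def emeasure_restart[OF e G] using rate_pos[OF e] total_rate_pos
    by (simp add: ennreal_zero_less_mult_iff)
  have leaves: "\<omega> (e, 0) \<ge> 0 \<and> state_at D N y \<omega> (\<omega> (e, 0)) = x"
    and no_return: "s < \<omega> (e, 0) \<or> state_at D N y \<omega> s \<noteq> y"
    and stays: "s < \<omega> (e, 0) \<longrightarrow> state_at D N y \<omega> s = y"
    if \<omega>: "\<omega> \<in> E" "regular_gaps N \<omega>" for \<omega> s
  proof -
    have first: "rings_first N e \<omega>" and never: "\<not> visits_within D N y n x (restart N e \<omega>)" for n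
      using \<omega>(1) by (auto simp: E_def G_def)
    have reg: "regular_gaps N (restart N e \<omega>)"
      by (rule regular_gaps_restart[OF \<omega>(2) e first])
    obtain e' where e': "e' \<in> clocks N" "rings_first N e' (restart N e \<omega>)"
      using ex_rings_first[OF reg] by blast
    have "0 < restart N e \<omega> (e', 0)"
      using reg e' by (simp add: regular_gaps_def)
    then have "state_at D N x (restart N e \<omega>) 0 = x"
      by (rule state_at_before(1)[OF reg e'(2)])
    moreover have "0 < \<omega> (e, 0)"
      using \<omega>(2) e by (simp add: regular_gaps_def)
    ultimately show "\<omega> (e, 0) \<ge> 0 \<and> state_at D N y \<omega> (\<omega> (e, 0)) = x"
      using state_at_after[OF \<omega>(2) e first order_refl, of D y] by (simp add: x_def)
    show "s < \<omega> (e, 0) \<longrightarrow> state_at D N y \<omega> s = y"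
      using state_at_before(1)[OF \<omega>(2) first] by blast
    show "s < \<omega> (e, 0) \<or> state_at D N y \<omega> s \<noteq> y"
      using state_at_after[OF \<omega>(2) e first, of s D y] state_at_visits_within[OF reg] never
      by (metis not_less x_def)
  qed
  have "\<not> absorbing D N y"
  proof
    assume "absorbing D N y"
    then have "AE \<omega> in poisson_space N. \<omega> \<notin> E"
      using AE_regular_gaps unfolding absorbing_def
      by eventually_elim (use leaves \<open>x \<noteq> y\<close> in blast)
    then have "emeasure (poisson_space N) E = 0"
      using E by (simp add: AE_iff_measurable[OF E] sets.sets_into_space[OF E, THEN subsetD] Int_def[symmetric]
          cong: conj_cong)
    then show False
      using Epos by simp
  qed
  moreover have "(\<integral>\<^sup>+ \<omega>. return_time D N y \<omega> \<partial>poisson_space N) = \<infinity>"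
  proof -
    have "\<infinity> = (\<integral>\<^sup>+ \<omega>. \<infinity> * indicator E \<omega> \<partial>poisson_space N)"
      using Epos by (subst nn_integral_cmult_indicator[OF E]) (simp add: ennreal_top_mult)
    also have "\<dots> \<le> (\<integral>\<^sup>+ \<omega>. return_time D N y \<omega> \<partial>poisson_space N)"
    proof (rule nn_integral_mono_AE)
      show "AE \<omega> in poisson_space N. \<infinity> * indicator E \<omega> \<le> return_time D N y \<omega>"
        using AE_regular_gaps
      proof eventually_elim
        case (elim \<omega>)
        have "return_time D N y \<omega> = \<infinity>" if "\<omega> \<in> E"
        proof -
          \<comment> \<open>A return at \<open>t\<close> needs an earlier time away from
            \<open>y\<close>. Before the first ring there is none, and from that ring on the path is
            never at \<open>y\<close>. The infimum of the empty set is infinite.\<close>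
          have "{t. \<exists>s. 0 \<le> s \<and> s < t \<and> state_at D N y \<omega> s \<noteq> y \<and> state_at D N y \<omega> t = y} = {}"
            using no_return[OF that elim] stays[OF that elim] by (blast dest: less_trans)
          then show ?thesis
            by (simp add: return_time_def)
        qed
        then show ?case
          by (auto simp: indicator_def)
      qed
    qed
    finally show ?thesis
      by (simp add: top_unique)
  qed
  ultimately show ?thesis
    by (simp add: positive_recurrent_state_def)
qed

end

section \<open>The example network\<close>

lemma clocks_example:
  assumes "\<epsilon> < 2"
  shows "clocks (example_network \<epsilon>)
    = {Arrival 1, Comm (1, 2), Comm (1, 3), Comm (2, 3), Comm (3, 2)}"
  using assms by (auto simp: clocks_def example_network_def)

lemma network_example: "\<epsilon> < 2 \<Longrightarrow> network (example_network \<epsilon>)"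
  by (auto simp: network_def example_network_def)

text \<open>A positive load forces node 1 into \<open>S\<close>. This leaves three cuts, each of
  capacity 2 against the load \<open>2 - \<epsilon>\<close>.\<close>

lemma cut_condition_example:
  assumes "0 < \<epsilon>"
  shows "cut_condition (example_network \<epsilon>)"
  unfolding cut_condition_def
proof (intro allI impI)
  fix S assume S: "S \<subset> nodes (example_network \<epsilon>)" and pos: "0 < (\<Sum>u\<in>S. arr (example_network \<epsilon>) u)"
  have "1 \<in> S"
  proof (rule ccontr)
    assume "1 \<notin> S"
    then have "(\<Sum>u\<in>S. arr (example_network \<epsilon>) u) = 0"
      by (intro sum.neutral) (auto simp: example_network_def)
    then show False
      using pos by simp
  qed
  have "S \<in> Pow {1, 2, 3}"
    using S by (auto simp: example_network_def)
  then have "S = {1} \<or> S = {1, 2} \<or> S = {1, 3}"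
    using S \<open>1 \<in> S\<close> by (auto simp: Pow_insert example_network_def)
  moreover have "{(u, v) \<in> links (example_network \<epsilon>). u \<in> {1} \<and> v \<notin> {1}} = {(1, 2), (1, 3)}"
    "{(u, v) \<in> links (example_network \<epsilon>). u \<in> {1, 2} \<and> v \<notin> {1, 2}} = {(1, 3), (2, 3)}"
    "{(u, v) \<in> links (example_network \<epsilon>). u \<in> {1, 3} \<and> v \<notin> {1, 3}} = {(1, 2), (3, 2)}"
    by (auto simp: example_network_def)
  ultimately show "(\<Sum>u\<in>S. arr (example_network \<epsilon>) u)
      < (\<Sum>l\<in>{(u, v) \<in> links (example_network \<epsilon>). u \<in> S \<and> v \<notin> S}. cap (example_network \<epsilon>) l)"
    using assms by (elim disjE) (simp_all only:, simp_all add: example_network_def)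
qed

section \<open>Reachable states and the number of missing receptions\<close>

definition reach_state :: "nat \<Rightarrow> nat \<Rightarrow> nat \<Rightarrow> nat state" where
  "reach_state a k m = replicate k (1, {1, a}) @ replicate m (1, {1})"

definition missing_receptions :: "nat state \<Rightarrow> nat" where
  "missing_receptions x = (\<Sum>p\<leftarrow>x. 3 - card (snd p))"

lemma oldest_useful_append:
  "oldest_useful (xs @ p # ys) l = Some (length xs)"
  if "\<forall>q\<in>set xs. \<not> useful q l" "useful p l"
proof -
  have "(LEAST i. i < length (xs @ p # ys) \<and> useful ((xs @ p # ys) ! i) l) = length xs"
    using that by (intro Least_equality) (auto simp: nth_append not_less[symmetric])
  moreover have "\<exists>i<length (xs @ p # ys). useful ((xs @ p # ys) ! i) l"
    using that by (intro exI[of _ "length xs"]) auto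
  ultimately show ?thesis
    by (simp add: oldest_useful_def)
qed

lemma transmit_oldest_useful:
  assumes "\<forall>q\<in>set xs. \<not> useful q l" "useful p l"
  shows "transmit oldest_useful l (xs @ p # ys) = xs @ (fst p, insert (snd l) (snd p)) # ys"
  using oldest_useful_append[OF assms] assms by (simp add: transmit_def)

lemma transmit_oldest_useful_idle:
  assumes "\<forall>q\<in>set x. \<not> useful q l"
  shows "transmit oldest_useful l x = x"
  using assms by (auto simp: transmit_def oldest_useful_def)

lemma reach_state_Suc1: "reach_state a (Suc k) m = [] @ (1, {1, a}) # reach_state a k m"
  by (simp add: reach_state_def)

lemma reach_state_Suc2: "reach_state a k (Suc m) = replicate k (1, {1, a}) @ (1, {1}) # replicate m (1, {1})"
  by (simp add: reach_state_def)

lemma reach_state_Suc_Suc: "replicate k (1, {1, a}) @ (1, {1, a}) # replicate m (1, {1}) = reach_state a (Suc k) m"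
  by (simp add: reach_state_def replicate_append_same[symmetric])

lemma missing_receptions_reach_state: "a \<noteq> 1 \<Longrightarrow> missing_receptions (reach_state a k m) = k + 2 * m"
  by (simp add: missing_receptions_def reach_state_def sum_list_replicate)

lemma discard_complete_reach_state:
  "a \<noteq> 1 \<Longrightarrow> discard_complete (example_network \<epsilon>) (reach_state a k m) = reach_state a k m"
  by (auto simp: discard_complete_def reach_state_def example_network_def filter_empty_conv intro!: filter_True)

lemma discard_complete_full:
  "a \<in> {2, 3} \<Longrightarrow> b \<in> {2, 3} \<Longrightarrow> a \<noteq> b \<Longrightarrow>
    discard_complete (example_network \<epsilon>) ((1, {b, 1, a}) # reach_state a k m) = reach_state a k m"
  using discard_complete_reach_state[of a \<epsilon> k m]
  by (auto simp: discard_complete_def example_network_def)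

section \<open>Transitions out of the reachable states\<close>

lemma step_arrival:
  assumes "a \<in> {2, 3}"
  shows "event_step oldest_useful (example_network \<epsilon>) (Arrival 1) (reach_state a k m) = reach_state a k (Suc m)"
proof -
  have "reach_state a k m @ [(1, {1})] = reach_state a k (Suc m)"
    by (simp add: reach_state_def replicate_append_same)
  then show ?thesis
    using assms discard_complete_reach_state[of a \<epsilon> k "Suc m"] by auto
qed

text \<open>The link skips the block already available at \<open>a\<close> and serves the first
  packet held by node 1 alone, which lies exactly at the boundary of the two blocks. Hence the
  common label \<open>a\<close> is preserved.\<close>

lemma step_same:
  assumes "a \<in> {2, 3}"
  shows "event_step oldest_useful (example_network \<epsilon>) (Comm (1, a)) (reach_state a k m)
    = (if m = 0 then reach_state a k m else reach_state a (Suc k) (m - 1))"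
proof (cases m)
  case 0
  have "transmit oldest_useful (1, a) (reach_state a k 0) = reach_state a k 0"
    by (rule transmit_oldest_useful_idle) (auto simp: reach_state_def useful_def)
  then show ?thesis
    using 0 assms discard_complete_reach_state[of a \<epsilon>] by auto
next
  case (Suc m')
  have "transmit oldest_useful (1, a) (reach_state a k m) = reach_state a (Suc k) m'"
    unfolding Suc reach_state_Suc2 using assms
    by (subst transmit_oldest_useful) (auto simp: useful_def insert_commute simp flip: reach_state_Suc_Suc)
  then show ?thesis
    using Suc assms discard_complete_reach_state[of a \<epsilon>] by auto
qed

text \<open>Both links into \<open>b\<close> compete for the same oldest packet and complete it.
  Here the discipline keeps \<open>(1, b)\<close> from supplying \<open>b\<close> with a packet that
  could later be sent to \<open>a\<close>.\<close>

lemma step_second_reception: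
  assumes "a \<in> {2, 3}" "b \<in> {2, 3}" "a \<noteq> b" "c \<in> {1, a}"
  shows "event_step oldest_useful (example_network \<epsilon>) (Comm (c, b)) (reach_state a (Suc k) m) = reach_state a k m"
proof -
  have "transmit oldest_useful (c, b) (reach_state a (Suc k) m) = (1, {b, 1, a}) # reach_state a k m"
    unfolding reach_state_Suc1 using assms
    by (subst transmit_oldest_useful) (auto simp: useful_def)
  then show ?thesis
    using discard_complete_full[OF assms(1-3)] by simp
qed

lemma step_second_idle:
  assumes "a \<in> {2, 3}" "b \<in> {2, 3}" "a \<noteq> b"
  shows "event_step oldest_useful (example_network \<epsilon>) (Comm (a, b)) (reach_state a 0 m) = reach_state a 0 m"
proof -
  have "transmit oldest_useful (a, b) (reach_state a 0 m) = reach_state a 0 m"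
    using assms by (intro transmit_oldest_useful_idle) (auto simp: reach_state_def useful_def)
  then show ?thesis
    using assms discard_complete_reach_state[of a \<epsilon>] by auto
qed

text \<open>No packet present is available at \<open>b\<close>, so this link wastes its whole
  capacity; the instability results from that loss.\<close>

lemma step_back_idle:
  assumes "a \<in> {2, 3}" "b \<in> {2, 3}" "a \<noteq> b"
  shows "event_step oldest_useful (example_network \<epsilon>) (Comm (b, a)) (reach_state a k m) = reach_state a k m"
proof -
  have "transmit oldest_useful (b, a) (reach_state a k m) = reach_state a k m"
    using assms by (intro transmit_oldest_useful_idle) (auto simp: reach_state_def useful_def)
  then show ?thesis
    using assms discard_complete_reach_state[of a \<epsilon>] by auto
qed

text \<open>Without a first block the label is arbitrary, and this is the only moment at which it
  can change.\<close>

lemma reach_state_0: "reach_state a 0 m = reach_state b 0 m"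
  by (simp add: reach_state_def)

definition reach_states :: "nat state set" where
  "reach_states = {reach_state a k m |a k m. a \<in> {2, 3}}"

lemma reach_statesI: "a \<in> {2, 3} \<Longrightarrow> reach_state a k m \<in> reach_states"
  by (auto simp: reach_states_def)

lemma missing_receptions_step:
  fixes a b k m :: nat and \<epsilon> :: real
  assumes ab: "a \<in> {2, 3}" "b \<in> {2, 3}" "a \<noteq> b"
  defines "F \<equiv> event_step oldest_useful (example_network \<epsilon>)" and "x \<equiv> reach_state a k m"
  shows "F (Arrival 1) x \<in> reach_states" "missing_receptions (F (Arrival 1) x) = missing_receptions x + 2"
    and "F (Comm (b, a)) x \<in> reach_states" "missing_receptions (F (Comm (b, a)) x) = missing_receptions x"
    and "\<And>l. l \<in> {(1, a), (1, b), (a, b)} \<Longrightarrow>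
      F (Comm l) x \<in> reach_states \<and> missing_receptions x \<le> Suc (missing_receptions (F (Comm l) x))"
proof -
  have w: "missing_receptions (reach_state a k m) = k + 2 * m" "missing_receptions (reach_state b k m) = k + 2 * m" for k m
    using ab by (auto simp: missing_receptions_reach_state)
  note r = reach_statesI[OF ab(1)] reach_statesI[OF ab(2)]
  show "F (Arrival 1) x \<in> reach_states" "missing_receptions (F (Arrival 1) x) = missing_receptions x + 2"
    unfolding F_def x_def step_arrival[OF ab(1)] by (simp_all add: w r)
  show "F (Comm (b, a)) x \<in> reach_states" "missing_receptions (F (Comm (b, a)) x) = missing_receptions x"
    unfolding F_def x_def step_back_idle[OF ab] by (simp_all add: w r)
  show "F (Comm l) x \<in> reach_states \<and> missing_receptions x \<le> Suc (missing_receptions (F (Comm l) x))"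
    if l: "l \<in> {(1, a), (1, b), (a, b)}" for l
  proof -
    consider "l = (1, a)" | c where "l = (c, b)" "c \<in> {1, a}"
      using l by auto
    then show ?thesis
    proof cases
      case 1
      then show ?thesis
        unfolding F_def x_def by (cases m) (simp_all add: step_same[OF ab(1)] w r del: event_step.simps One_nat_def)
    next
      case 2
      show ?thesis
      proof (cases k)
        case (Suc k')
        then show ?thesis
          unfolding F_def x_def using step_second_reception[OF ab 2(2)]
          by (simp add: 2(1) w r del: event_step.simps One_nat_def)
      next
        case 0
        \<comment> \<open>With \<open>k = 0\<close> the state may be relabelled with
          \<open>b\<close>, after which \<open>(1, b)\<close> acts as the link that extends the
          first block.\<close>
        have "F (Comm (1, b)) x = (if m = 0 then reach_state b 0 m else reach_state b (Suc 0) (m - 1))"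
          unfolding F_def x_def 0 reach_state_0[of a m b] by (rule step_same[OF ab(2)])
        moreover have "F (Comm (a, b)) x = x"
          unfolding F_def x_def 0 by (rule step_second_idle[OF ab])
        ultimately show ?thesis
          using 2 0 by (auto simp: x_def w r simp del: One_nat_def)
      qed
    qed
  qed
qed

lemma unstable_example:
  assumes \<epsilon>: "0 < \<epsilon>" "\<epsilon> < 1 / 10"
  shows "\<not> stable_network oldest_useful (example_network \<epsilon>)"
proof -
  let ?N = "example_network \<epsilon>"
  let ?F = "event_step oldest_useful ?N"
  have clk: "clocks ?N = {Arrival 1, Comm (1, 2), Comm (1, 3), Comm (2, 3), Comm (3, 2)}"
    using \<epsilon> by (intro clocks_example) simp
  have sum_clk: "(\<Sum>e\<in>clocks ?N. event_rate ?N e * f e)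
      = (2 - \<epsilon>) * f (Arrival 1) + f (Comm (1, 2)) + f (Comm (1, 3)) + f (Comm (2, 3)) + f (Comm (3, 2))"
    for f :: "nat event \<Rightarrow> real"
    unfolding clk by (simp add: example_network_def)
  interpret finite_clocks ?N
    by standard (auto simp: clk)
  have total: "total_rate = 6 - \<epsilon>"
    using sum_clk[of "\<lambda>_. 1"] by simp
  define h :: "nat state \<Rightarrow> real" where "h x = (9 / 10) ^ missing_receptions x" for x
  have up: "h x' = 81 / 100 * h x" if "missing_receptions x' = missing_receptions x + 2" for x x'
    using that by (simp add: h_def power_add power2_eq_square)
  \<comment> \<open>An inequality is what is available here, because a link may also find nothing
    useful.\<close>
  have down: "h x' \<le> 10 / 9 * h x" if "missing_receptions x \<le> Suc (missing_receptions x')" for x x'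
  proof -
    have "(9 / 10) ^ Suc (missing_receptions x') \<le> ((9 / 10) ^ missing_receptions x :: real)"
      using that by (intro power_decreasing) auto
    then show ?thesis
      by (simp add: h_def)
  qed
  have step: "?F e x \<in> reach_states" if x: "x \<in> reach_states" and e: "e \<in> clocks ?N" for x e
  proof -
    obtain a b k m where "a \<in> {2, 3}" "b \<in> {2, 3}" "a \<noteq> b" and x: "x = reach_state a k m"
      using x unfolding reach_states_def by fastforce
    note ws = missing_receptions_step[OF this(1-3), where \<epsilon>=\<epsilon> and k=k and m=m, folded x]
    have "e \<in> {Arrival 1, Comm (b, a), Comm (1, a), Comm (1, b), Comm (a, b)}"
      using e \<open>a \<in> {2, 3}\<close> \<open>b \<in> {2, 3}\<close> \<open>a \<noteq> b\<close> unfolding clk by auto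
    then show ?thesis
      using ws by (auto simp del: event_step.simps One_nat_def)
  qed
  have super: "(\<Sum>e\<in>clocks ?N. event_rate ?N e * h (?F e x)) \<le> total_rate * h x"
    if xR: "x \<in> reach_states" for x
  proof -
    obtain a b k m where ab: "a \<in> {2, 3}" "b \<in> {2, 3}" "a \<noteq> b" and x: "x = reach_state a k m"
      using xR unfolding reach_states_def by fastforce
    note ws = missing_receptions_step[OF ab, where \<epsilon>=\<epsilon> and k=k and m=m, folded x]
    have arrival: "h (?F (Arrival 1) x) = 81 / 100 * h x"
      by (rule up[OF ws(2)])
    have "h (?F (Comm (b, a)) x) = h x"
      using ws(4) by (simp add: h_def)
    moreover have "h (?F (Comm (1, a)) x) \<le> 10 / 9 * h x" "h (?F (Comm (1, b)) x) \<le> 10 / 9 * h x"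
      "h (?F (Comm (a, b)) x) \<le> 10 / 9 * h x"
      by (rule down, use ws(5) in blast)+
    ultimately have "(\<Sum>e\<in>clocks ?N. event_rate ?N e * h (?F e x))
        \<le> (2 - \<epsilon>) * (81 / 100 * h x) + h x + 3 * (10 / 9 * h x)"
      unfolding sum_clk arrival using ab by (auto simp del: event_step.simps One_nat_def)
    also have "\<dots> = (2 - \<epsilon>) * (81 / 100) * h x + 13 / 3 * h x"
      by (simp add: algebra_simps)
    also have "\<dots> = ((2 - \<epsilon>) * (81 / 100) + 13 / 3) * h x"
      by (simp only: distrib_right)
    also have "\<dots> \<le> total_rate * h x"
    proof (rule mult_right_mono)
      \<comment> \<open>Here \<open>13/3\<close> is 1 for the idle link plus three times
        \<open>10/9\<close>. The inequality amounts to \<open>\<epsilon> \<le> 14/57\<close>, so the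
        threshold \<open>1/10\<close> leaves room.\<close>
      show "(2 - \<epsilon>) * (81 / 100) + 13 / 3 \<le> total_rate"
        unfolding total using \<epsilon> by (simp add: field_simps)
    qed (simp add: h_def)
    finally show ?thesis .
  qed
  have empty: "[] \<in> reach_states" "missing_receptions [] = 0"
    using reach_statesI[of 2 0 0] by (auto simp: reach_state_def missing_receptions_def)
  have "[] = reach_state 2 0 0"
    by (simp add: reach_state_def)
  then have "missing_receptions (?F (Arrival 1) []) = 2"
    using missing_receptions_step(2)[of 2 3, where \<epsilon>=\<epsilon> and k=0 and m=0] empty(2) by (simp del: event_step.simps One_nat_def)
  \<comment> \<open>The criterion is applied at the empty state, where \<open>h\<close> is 1; one
    arrival leads to a state with \<open>h\<close> equal to \<open>81/100\<close>.\<close>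
  then have "\<not> positive_recurrent_state oldest_useful ?N []"
    by (intro not_positive_recurrent_state[of reach_states _ h _ "Arrival 1"] step super)
       (auto simp: h_def empty clk power2_eq_square simp del: event_step.simps One_nat_def)
  then show ?thesis
    using state_space.empty unfolding stable_network_def by blast
qed

theorem mainTheorem2:
  shows "(\<exists>\<delta>>0. \<forall>\<epsilon>. 0 < \<epsilon> \<and> \<epsilon> < \<delta> \<longrightarrow>
            cut_condition (example_network \<epsilon>) \<and> \<not> stable_network oldest_useful (example_network \<epsilon>))
         \<and> \<not> achieves_max_stability_region (oldest_useful :: nat discipline)"
proof
  show "\<exists>\<delta>>0. \<forall>\<epsilon>. 0 < \<epsilon> \<and> \<epsilon> < \<delta> \<longrightarrow>
      cut_condition (example_network \<epsilon>) \<and> \<not> stable_network oldest_useful (example_network \<epsilon>)"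
    using cut_condition_example unstable_example by (intro exI[of _ "1 / 10"]) auto
  have "network (example_network (1 / 20))" "cut_condition (example_network (1 / 20))"
    "\<not> stable_network oldest_useful (example_network (1 / 20))"
    using network_example cut_condition_example unstable_example by auto
  then show "\<not> achieves_max_stability_region (oldest_useful :: nat discipline)"
    unfolding achieves_max_stability_region_def by blast
qed

end
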